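(* Let $n\ge 1$, $T>0$, and suppose: $\ell:\mathbb{R}^n\to\mathbb{R}$ is $C^2$, strictly convex, $\lim_{|u|\to\infty}\ell(u)/|u|=\infty$, and $\nabla^2\ell(u)$ is positive definite for every $u\in\mathbb{R}^n$; $g:\mathbb{R}^n\to\mathbb{R}$ is globally Lipschitz and differentiable; $d:[0,T]\times[0,T]\to(a,1]$, $(t,s)\mapsto d_t(s)$, with $a>0$, is Lipschitz continuous with $d_t(t)=1$ for each $t$, and for every $t\le s\le T$, $d_t(s)$ and $\frac{\partial}{\partial t}d_t(s)$ are continuous in $t$ and summable in $s$. Let $$v(x,t)=\inf_{y\in \mathrm{AC}_{x,t}}\left\{\int_t^T d_t(s)\,\ell(\dot y(s))\,ds+d_t(T)\,g(y(T))\right\}.$$ Then at every point $(x,t)\in\mathbb{R}^n\times(0,T)$ at which $v$ is differentiable, $$-v_t(x,t)+\ell^*(-v_x(x,t))+w\big(x,t,\iota(-v_x(x,t))\big)=0.$$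
   Context: $\mathrm{AC}_{x,t}$ is the set of absolutely continuous $y:[t,T]\to\mathbb{R}^n$ with $y(t)=x$. $\ell^*(p)=\sup_{u\in\mathbb{R}^n}\{p\cdot u-\ell(u)\}$. $v_x$ is the gradient in $x$, $v_t$ the derivative in $t$. $\iota=(\nabla\ell)^{-1}$ is the inverse function of the bijection $\nabla\ell:\mathbb{R}^n\to\mathbb{R}^n$, and $d_t^{-1}(s)=1/d_t(s)$. For $x,\alpha\in\mathbb{R}^n$, $0\le t\le s\le T$: $$U_{t,\alpha}(s)=\iota(d_t^{-1}(s)\nabla\ell(\alpha)),\qquad Y_{t,x,\alpha}(s)=x+\int_t^s U_{t,\alpha}(r)\,dr,$$ $$w(x,t,\alpha)=\int_t^T\frac{\partial d_t}{\partial t}(s)\,\ell(U_{t,\alpha}(s))\,ds+\frac{\partial d_t}{\partial t}(T)\,g(Y_{t,x,\alpha}(T)).$$ Only the values $d_t(s)$ with $t\le s$ enter. *)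

theory Defs
  imports "HOL-Analysis.Analysis"
begin

definition gradient :: "('a::real_inner \<Rightarrow> real) \<Rightarrow> 'a \<Rightarrow> 'a" where
  "gradient f x = (THE D. GDERIV f x :> D)"

definition hessian :: "(real^'n \<Rightarrow> real) \<Rightarrow> real^'n \<Rightarrow> real^'n^'n" where
  "hessian f u = jacobian (gradient f) (at u)"

definition C2 :: "(real^'n \<Rightarrow> real) \<Rightarrow> bool" where
  "C2 f \<longleftrightarrow> (\<forall>u. f differentiable (at u)) \<and> (\<forall>u. gradient f differentiable (at u)) \<and>
     continuous_on UNIV (hessian f)"

definition positive_definite :: "real^'n^'n \<Rightarrow> bool" where
  "positive_definite A \<longleftrightarrow> transpose A = A \<and> (\<forall>z. z \<noteq> 0 \<longrightarrow> z \<bullet> (A *v z) > 0)"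

definition strictly_convex :: "('a::real_vector \<Rightarrow> real) \<Rightarrow> bool" where
  "strictly_convex f \<longleftrightarrow> (\<forall>u z. \<forall>\<theta>\<in>{0<..<1}. u \<noteq> z \<longrightarrow>
     f ((1 - \<theta>) *\<^sub>R u + \<theta> *\<^sub>R z) < (1 - \<theta>) * f u + \<theta> * f z)"

text \<open>The finite set \<open>I\<close> of pairs lists the endpoints of finitely many non-overlapping subintervals
  of \<open>[t, T]\<close>.\<close>

definition absolutely_continuous_on_interval ::
    "real \<Rightarrow> real \<Rightarrow> (real \<Rightarrow> 'a::real_normed_vector) \<Rightarrow> bool" where
  "absolutely_continuous_on_interval t T y \<longleftrightarrow>
     (\<forall>\<epsilon>>0. \<exists>\<delta>>0. \<forall>I. finite I \<and> (\<forall>(a, b)\<in>I. t \<le> a \<and> a \<le> b \<and> b \<le> T) \<and>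
        disjoint_family_on (\<lambda>(a, b). {a<..<b}) I \<and> (\<Sum>(a, b)\<in>I. b - a) < \<delta> \<longrightarrow>
        (\<Sum>(a, b)\<in>I. norm (y b - y a)) < \<epsilon>)"

text \<open>Curves are total functions on \<open>real\<close>; only their values on \<open>[t, T]\<close> matter, both here and in
  the cost below.\<close>

definition AC :: "real \<Rightarrow> real^'n \<Rightarrow> real \<Rightarrow> (real \<Rightarrow> real^'n) set" where
  "AC T x t = {y. absolutely_continuous_on_interval t T y \<and> y t = x}"

text \<open>The Lebesgue integral with values in \<open>ereal\<close>: positive part minus negative part. Below the
  negative part is always finite (a superlinear continuous running cost is bounded below), so that
  the running cost of a curve is a well-defined element of \<open>(-\<infinity>, \<infinity>]\<close>.\<close>

definition extended_integral :: "'a measure \<Rightarrow> ('a \<Rightarrow> real) \<Rightarrow> ereal" where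
  "extended_integral M f =
     enn2ereal (\<integral>\<^sup>+ s. ennreal (f s) \<partial>M) - enn2ereal (\<integral>\<^sup>+ s. ennreal (- f s) \<partial>M)"

text \<open>The derivative of an absolutely continuous curve exists almost everywhere; the arbitrary value
  of \<open>vector_derivative\<close> on the exceptional null set does not affect the integral over the
  (complete) Lebesgue measure.\<close>

definition cost :: "real \<Rightarrow> (real^'n \<Rightarrow> real) \<Rightarrow> (real^'n \<Rightarrow> real) \<Rightarrow> (real \<Rightarrow> real \<Rightarrow> real) \<Rightarrow>
    real \<Rightarrow> (real \<Rightarrow> real^'n) \<Rightarrow> ereal" where
  "cost T \<l> g d t y =
     extended_integral (lebesgue_on {t..T})
       (\<lambda>s. d t s * \<l> (vector_derivative y (at s within {t..T})))
     + ereal (d t T * g (y T))"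

text \<open>Under the standing assumptions the infimum is finite, so the conversion to \<open>real\<close> loses
  nothing.\<close>

definition value_function :: "real \<Rightarrow> (real^'n \<Rightarrow> real) \<Rightarrow> (real^'n \<Rightarrow> real) \<Rightarrow>
    (real \<Rightarrow> real \<Rightarrow> real) \<Rightarrow> real^'n \<Rightarrow> real \<Rightarrow> real" where
  "value_function T \<l> g d x t = real_of_ereal (INF y\<in>AC T x t. cost T \<l> g d t y)"

definition conjugate :: "(real^'n \<Rightarrow> real) \<Rightarrow> real^'n \<Rightarrow> real" where
  "conjugate \<l> p = (SUP u. p \<bullet> u - \<l> u)"

definition iota :: "(real^'n \<Rightarrow> real) \<Rightarrow> real^'n \<Rightarrow> real^'n" where
  "iota \<l> = inv (gradient \<l>)"

text \<open>Only the values of the discount \<open>d t s\<close> with \<open>t \<le> s\<close> enter, hence the derivative in \<open>t\<close> is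
  taken within \<open>[0, s]\<close>: two-sided for \<open>0 < t < s\<close>, one-sided at the end points.\<close>

definition d_dt :: "(real \<Rightarrow> real \<Rightarrow> real) \<Rightarrow> real \<Rightarrow> real \<Rightarrow> real" where
  "d_dt d t s = vector_derivative (\<lambda>\<tau>. d \<tau> s) (at t within {0..s})"

definition U :: "(real^'n \<Rightarrow> real) \<Rightarrow> (real \<Rightarrow> real \<Rightarrow> real) \<Rightarrow> real \<Rightarrow> real^'n \<Rightarrow> real \<Rightarrow> real^'n" where
  "U \<l> d t \<alpha> s = iota \<l> ((1 / d t s) *\<^sub>R gradient \<l> \<alpha>)"

definition Y :: "(real^'n \<Rightarrow> real) \<Rightarrow> (real \<Rightarrow> real \<Rightarrow> real) \<Rightarrow> real \<Rightarrow> real^'n \<Rightarrow> real^'n \<Rightarrow>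
    real \<Rightarrow> real^'n" where
  "Y \<l> d t x \<alpha> s = x + (LINT r:{t..s}|lebesgue. U \<l> d t \<alpha> r)"

definition w :: "real \<Rightarrow> (real^'n \<Rightarrow> real) \<Rightarrow> (real^'n \<Rightarrow> real) \<Rightarrow> (real \<Rightarrow> real \<Rightarrow> real) \<Rightarrow>
    real^'n \<Rightarrow> real \<Rightarrow> real^'n \<Rightarrow> real" where
  "w T \<l> g d x t \<alpha> =
     (LINT s:{t..T}|lebesgue. d_dt d t s * \<l> (U \<l> d t \<alpha> s)) + d_dt d t T * g (Y \<l> d t x \<alpha> T)"

end

theory Submission
  imports Defs
begin

text \<open>
  For fixed \<open>t\<close> the running cost does not depend on the state, so minimizers can be computed:
  a control \<open>u\<close> for which \<open>d t s *\<^sub>R gradient \<l> (u s)\<close> is a constant \<open>p\<close> is, by convexity, optimal among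
  all curves with the same end points. Such an extremal reaches every end point, because its
  displacement as a function of \<open>p\<close> is the gradient of a coercive convex function, and the
  infimum over \<open>p\<close> is attained. At a point where the value function \<open>v\<close> is differentiable, moving
  the initial point while keeping the final point fixed gives \<open>v_x = - p\<close>. Along the extremal
  \<open>y\<close> itself, \<open>v (y \<tau>) \<tau>\<close> is at most the cost of the remaining piece of \<open>y\<close> evaluated with the
  discount \<open>d \<tau>\<close>, with equality at \<open>\<tau> = t\<close>; equating the derivatives at the touching point
  gives the equation, and the derivative of the discount in its first argument produces \<open>w\<close>.

  The comparison with arbitrary admissible curves needs the fundamental theorem of calculus
  for absolutely continuous functions, which is obtained from Vitali's covering theorem.
\<close>

section \<open>Absolutely continuous curves\<close>

text \<open>A one-sided comparison on a two-sided time neighbourhood replaces it: two functions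
  differentiable at an interior point, one below the other and touching it there, have the same
  derivative at that point. With \<open>\<alpha> = iota l p\<close>, equality of the derivatives
  reads \<open>- (\<alpha> \<bullet> p) + v_t = - l \<alpha> + w\<close>. Since
  \<open>\<alpha> \<bullet> p - l \<alpha>\<close> is the conjugate at \<open>p = - v_x\<close>,
  this is the claimed equation. The term \<open>- l \<alpha>\<close> comes from the moving lower
  limit of the running cost, with weight \<open>d t t = 1\<close>. The function \<open>g\<close> is
  not assumed convex, so the optimal \<open>p\<close> is found not from a stationarity condition but
  as a minimizer of a continuous function with bounded sublevel sets. Competing curves may have
  unbounded derivatives and infinite cost, which is why their derivatives must be handled almost
  everywhere.\<close>

lemma sum_interval_lengths:
  fixes I :: "(real \<times> real) set"
  assumes "finite I" and "disjoint_family_on (\<lambda>(a, b). {a<..<b}) I" and "\<forall>(a, b)\<in>I. a \<le> b"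
  shows "measure lebesgue (\<Union>(a, b)\<in>I. {a<..<b}) = (\<Sum>(a, b)\<in>I. b - a)"
proof -
  have "measure lebesgue (\<Union>(a, b)\<in>I. {a<..<b}) = (\<Sum>(a, b)\<in>I. measure lebesgue {a<..<b})"
    using measure_finite_Union[OF assms(1), of "\<lambda>(a, b). {a<..<b}" lebesgue] assms(2,3)
    by (force simp: split_beta)
  also have "\<dots> = (\<Sum>(a, b)\<in>I. b - a)"
    using assms(3) by (intro sum.cong) auto
  finally show ?thesis .
qed

text \<open>Vitali's theorem gives countably many disjoint intervals covering almost all of
  \<open>S\<close>; finitely many of them already cover all but \<open>e\<close>, by continuity of
  the measure. The conclusion measures the covered part of \<open>S\<close>, so that a second
  covering can start from that part.\<close>

lemma Vitali_finite_intervals: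
  fixes S :: "real set"
  assumes S: "S \<in> lmeasurable" and "e > 0"
    and fine: "\<And>x h. x \<in> S \<Longrightarrow> h > 0 \<Longrightarrow> \<exists>a b. a < x \<and> x < b \<and> b - a < h \<and> Q a b"
  obtains I where "finite I" "\<forall>(a, b)\<in>I. a < b \<and> Q a b"
    "disjoint_family_on (\<lambda>(a, b). {a<..<b}) I"
    "measure lebesgue S - e < measure lebesgue (S \<inter> (\<Union>(a, b)\<in>I. {a<..<b}))"
proof -
  define K where "K = {(a, b). a < b \<and> Q a b}"
  \<comment> \<open>Open intervals are the balls of the real line; midpoint and half the length
    translate between the two.\<close>
  define m r where "m = (\<lambda>(a::real, b). (a + b) / 2)" and "r = (\<lambda>(a::real, b). (b - a) / 2)"
  have ball: "ball (m i) (r i) = (case i of (a, b) \<Rightarrow> {a<..<b})" for i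
    by (auto simp: m_def r_def ball_eq_greaterThanLessThan field_simps split: prod.splits)
  have "\<exists>i. i \<in> K \<and> x \<in> ball (m i) (r i) \<and> r i < h" if xh: "x \<in> S" "h > 0" for x h
  proof -
    obtain a b where "a < x" "x < b" "b - a < h" "Q a b" using fine[OF xh] by blast
    then show ?thesis
      by (intro exI[of _ "(a, b)"]) (simp add: K_def ball, simp add: r_def)
  qed
  then obtain C where C: "countable C" "C \<subseteq> K"
    "pairwise (\<lambda>i j. disjnt (ball (m i) (r i)) (ball (m j) (r j))) C"
    "negligible (S - (\<Union>i\<in>C. ball (m i) (r i)))"
    by (rule Vitali_covering_theorem_balls)
  define B where "B i = ball (m i) (r i)" for i
  \<comment> \<open>Traces on \<open>S\<close> instead of the intervals themselves: all their finite
    unions have measure at most that of \<open>S\<close>, the uniform bound that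
    \<open>measure_countable_Union_approachable\<close> asks for.\<close>
  define \<D> where "\<D> = (\<lambda>i. S \<inter> B i) ` C"
  have lm: "D \<in> lmeasurable" if "D \<in> \<D>" for D
    using that S by (auto simp: \<D>_def B_def intro!: fmeasurable_Int_fmeasurable)
  have "measure lebesgue (\<Union>D') \<le> measure lebesgue S" if "D' \<subseteq> \<D>" "finite D'" for D'
    using that lm by (intro measure_mono_fmeasurable S) (auto simp: \<D>_def intro!: sets.finite_Union fmeasurableD)
  then obtain D' where D': "D' \<subseteq> \<D>" "finite D'" "measure lebesgue (\<Union>\<D>) - e < measure lebesgue (\<Union>D')"
    using measure_countable_Union_approachable[of \<D> e "measure lebesgue S"] C(1) \<open>e > 0\<close> lm
    by (metis \<D>_def countable_image)
  then obtain I where I: "I \<subseteq> C" "finite I" "D' = (\<lambda>i. S \<inter> B i) ` I"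
    unfolding \<D>_def by (meson finite_subset_image)
  have "measure lebesgue (\<Union>\<D>) = measure lebesgue S"
  proof (rule measure_negligible_symdiff)
    have "\<Union>\<D> - S \<union> (S - \<Union>\<D>) = S - (\<Union>i\<in>C. B i)"
      by (auto simp: \<D>_def)
    with C(4) show "negligible (S - \<Union>\<D> \<union> (\<Union>\<D> - S))"
      by (simp add: B_def Un_commute)
  qed (use S in auto)
  moreover have "\<Union>D' = S \<inter> (\<Union>(a, b)\<in>I. {a<..<b})"
    using I ball by (auto simp: B_def split_beta)
  ultimately have "measure lebesgue S - e < measure lebesgue (S \<inter> (\<Union>(a, b)\<in>I. {a<..<b}))"
    using D'(3) by simp
  moreover have "\<forall>(a, b)\<in>I. a < b \<and> Q a b"
    using I(1) C(2) by (auto simp: K_def)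
  moreover have "disjoint_family_on (\<lambda>(a, b). {a<..<b}) I"
  proof (unfold disjoint_family_on_def, intro ballI impI)
    fix i j assume "i \<in> I" "j \<in> I" "i \<noteq> j"
    then have "disjnt (ball (m i) (r i)) (ball (m j) (r j))"
      using C(3) I(1) by (meson pairwiseD subsetD)
    then show "(case i of (a, b) \<Rightarrow> {a<..<b}) \<inter> (case j of (a, b) \<Rightarrow> {a<..<b}) = {}"
      by (simp only: ball disjnt_def)
  qed
  ultimately show ?thesis
    using that I(2) by blast
qed

text \<open>Induction on the number of intervals, removing the one that ends last: the others end no
  later than it starts, and the only new gap lies between its right end point and \<open>b\<close>.
  One family \<open>K\<close> serves all \<open>f\<close>, because it is used both with the
  identity, for lengths, and with \<open>y\<close>, for increments.\<close>

lemma complementary_intervals: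
  fixes J :: "(real \<times> real) set"
  assumes "finite J" and "a \<le> b" and "\<forall>(c, e)\<in>J. a \<le> c \<and> c < e \<and> e \<le> b"
    and "disjoint_family_on (\<lambda>(c, e). {c<..<e}) J"
  shows "\<exists>K. finite K \<and> (\<forall>(c, e)\<in>K. a \<le> c \<and> c < e \<and> e \<le> b) \<and>
    disjoint_family_on (\<lambda>(c, e). {c<..<e}) K \<and>
    (\<forall>f :: real \<Rightarrow> real. (\<Sum>(c, e)\<in>J. f e - f c) + (\<Sum>(c, e)\<in>K. f e - f c) = f b - f a)"
  using assms
proof (induction "card J" arbitrary: J b)
  case 0
  then show ?case
    by (intro exI[of _ "if a < b then {(a, b)} else {}"]) (auto simp: disjoint_family_on_def)
next
  case (Suc n)
  have "J \<noteq> {}" using Suc.hyps(2) by auto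
  define M where "M = Max (snd ` J)"
  have "M \<in> snd ` J"
    unfolding M_def using Suc.prems(1) \<open>J \<noteq> {}\<close> by (intro Max_in) auto
  then obtain c where cM: "(c, M) \<in> J" by auto
  have M: "e \<le> M" if "(c', e) \<in> J" for c' e
    unfolding M_def using Suc.prems(1) that by (intro Max_ge) (auto intro: rev_image_eqI)
  define J' where "J' = J - {(c, M)}"
  have *: "e \<le> c" if "(c', e) \<in> J'" for c' e
  proof (rule ccontr)
    assume "\<not> e \<le> c"
    have "(c', e) \<in> J" "(c', e) \<noteq> (c, M)" using that by (auto simp: J'_def)
    then have "{c'<..<e} \<inter> {c<..<M} = {}"
      using disjoint_family_onD[OF Suc.prems(4) _ cM] by fastforce
    have "c' < e" "e \<le> M"
      using Suc.prems(3) cM \<open>(c', e) \<in> J\<close> M by auto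
    \<comment> \<open>Since \<open>e \<le> M\<close>, an interval reaching beyond \<open>c\<close>
      would share this midpoint with the interval that ends last.\<close>
    then have "(max c c' + e) / 2 \<in> {c'<..<e} \<inter> {c<..<M}"
      using \<open>\<not> e \<le> c\<close> \<open>c' < e\<close> \<open>e \<le> M\<close> by auto
    with \<open>{c'<..<e} \<inter> {c<..<M} = {}\<close> show False by auto
  qed
  have cM': "a \<le> c" "c < M" "M \<le> b" using Suc.prems(3) cM by auto
  have "n = card J'" using Suc.prems(1) Suc.hyps(2) cM by (simp add: J'_def card_Diff_singleton)
  moreover have "disjoint_family_on (\<lambda>(c, e). {c<..<e}) J'"
    using Suc.prems(4) by (rule disjoint_family_on_mono[rotated]) (auto simp: J'_def)
  moreover have "\<forall>(c', e)\<in>J'. a \<le> c' \<and> c' < e \<and> e \<le> c"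
    using * Suc.prems(3) by (auto simp: J'_def)
  ultimately obtain K where K: "finite K" "\<forall>(c', e)\<in>K. a \<le> c' \<and> c' < e \<and> e \<le> c"
    "disjoint_family_on (\<lambda>(c, e). {c<..<e}) K"
    "\<And>f :: real \<Rightarrow> real. (\<Sum>(c, e)\<in>J'. f e - f c) + (\<Sum>(c, e)\<in>K. f e - f c) = f c - f a"
    using Suc.hyps(1)[of J' c] Suc.prems(1) cM' by (auto simp: J'_def)
  have sumJ: "(\<Sum>(c, e)\<in>J. f e - f c) = (\<Sum>(c, e)\<in>J'. f e - f c) + (f M - f c)" for f :: "real \<Rightarrow> real"
    using sum.remove[OF Suc.prems(1) cM, of "\<lambda>(c, e). f e - f c"] by (simp add: J'_def)
  show ?case
  proof (cases "M < b")
    case True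
    have "(M, b) \<notin> K" using K(2) cM' by auto
    moreover have "disjoint_family_on (\<lambda>(c, e). {c<..<e}) (insert (M, b) K)"
    proof -
      have "(case j of (c, e) \<Rightarrow> {c<..<e}) \<inter> {M<..<b} = {}" if "j \<in> K" for j
        using K(2) cM' that by fastforce
      then show ?thesis
        using K(3) \<open>(M, b) \<notin> K\<close> by (subst disjoint_family_on_insert) auto
    qed
    moreover have "(\<Sum>(c, e)\<in>J. f e - f c) + (\<Sum>(c, e)\<in>insert (M, b) K. f e - f c) = f b - f a"
      for f :: "real \<Rightarrow> real"
      using K(1) K(4)[of f] \<open>(M, b) \<notin> K\<close> sumJ[of f] by simp
    moreover have "\<forall>(c, e)\<in>insert (M, b) K. a \<le> c \<and> c < e \<and> e \<le> b"
      using K(2) cM' True by auto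
    ultimately show ?thesis
      using K(1) by (intro exI[of _ "insert (M, b) K"]) blast
  next
    case False
    then have "M = b" using cM' by simp
    have "(\<Sum>(c, e)\<in>J. f e - f c) + (\<Sum>(c, e)\<in>K. f e - f c) = f b - f a"
      for f :: "real \<Rightarrow> real"
      using K(4)[of f] sumJ[of f] \<open>M = b\<close> by simp
    moreover have "\<forall>(c, e)\<in>K. a \<le> c \<and> c < e \<and> e \<le> b"
      using K(2) cM' by auto
    ultimately show ?thesis
      using K(1,3) by (intro exI[of _ K]) blast
  qed
qed

section \<open>Absolute continuity and derivates\<close>

definition nonoverlapping_in :: "real \<Rightarrow> real \<Rightarrow> (real \<times> real) set \<Rightarrow> bool" where
  "nonoverlapping_in t T I \<longleftrightarrow> finite I \<and> (\<forall>(a, b)\<in>I. t \<le> a \<and> a \<le> b \<and> b \<le> T) \<and>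
     disjoint_family_on (\<lambda>(a, b). {a<..<b}) I"

lemma absolutely_continuous_on_intervalD:
  assumes "absolutely_continuous_on_interval t T y" "\<epsilon> > 0"
  obtains \<delta> where "\<delta> > 0"
    "\<And>I. nonoverlapping_in t T I \<Longrightarrow> (\<Sum>(a, b)\<in>I. b - a) < \<delta> \<Longrightarrow> (\<Sum>(a, b)\<in>I. norm (y b - y a)) < \<epsilon>"
proof -
  obtain \<delta> where "\<delta> > 0" and \<delta>: "\<forall>I. finite I \<and> (\<forall>(a, b)\<in>I. t \<le> a \<and> a \<le> b \<and> b \<le> T) \<and>
      disjoint_family_on (\<lambda>(a, b). {a<..<b}) I \<and> (\<Sum>(a, b)\<in>I. b - a) < \<delta> \<longrightarrow>
      (\<Sum>(a, b)\<in>I. norm (y b - y a)) < \<epsilon>"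
    using assms(1)[unfolded absolutely_continuous_on_interval_def, THEN spec, THEN mp, OF assms(2)]
    by (elim exE conjE) (rule that)
  show ?thesis
    by (rule that[OF \<open>\<delta> > 0\<close>]) (use \<delta> in \<open>simp add: nonoverlapping_in_def\<close>)
qed

lemma absolutely_continuous_imp_continuous_on:
  assumes "absolutely_continuous_on_interval t T y"
  shows "continuous_on {t..T} y"
  unfolding continuous_on_iff
proof (intro ballI allI impI)
  fix x and \<epsilon> :: real assume x: "x \<in> {t..T}" "\<epsilon> > 0"
  obtain \<delta> where \<delta>: "\<delta> > 0" and *:
    "\<And>I. nonoverlapping_in t T I \<Longrightarrow> (\<Sum>(a, b)\<in>I. b - a) < \<delta> \<Longrightarrow> (\<Sum>(a, b)\<in>I. norm (y b - y a)) < \<epsilon>"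
    using absolutely_continuous_on_intervalD[OF assms x(2)] by metis
  have "norm (y b - y a) < \<epsilon>" if "t \<le> a" "a \<le> b" "b \<le> T" "b - a < \<delta>" for a b
    using *[of "{(a, b)}"] that by (auto simp: nonoverlapping_in_def disjoint_family_on_def)
  then have "dist (y z) (y x) < \<epsilon>" if "z \<in> {t..T}" "dist z x < \<delta>" for z
    using that x by (smt (verit, best) atLeastAtMost_iff dist_real_def dist_norm norm_minus_commute)
  with \<delta> show "\<exists>d>0. \<forall>x'\<in>{t..T}. dist x' x < d \<longrightarrow> dist (y x') (y x) < \<epsilon>" by blast
qed

lemma absolutely_continuous_on_interval_inner:
  fixes y :: "real \<Rightarrow> 'a::real_inner"
  assumes "absolutely_continuous_on_interval t T y" and "norm i \<le> 1"
  shows "absolutely_continuous_on_interval t T (\<lambda>s. y s \<bullet> i)"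
proof -
  have "norm (y b \<bullet> i - y a \<bullet> i) \<le> norm (y b - y a)" for a b
    using Cauchy_Schwarz_ineq2[of "y b - y a" i] mult_left_mono[OF assms(2), of "norm (y b - y a)"]
    by (simp add: inner_diff_left)
  then have "(\<Sum>(a, b)\<in>I. norm (y b \<bullet> i - y a \<bullet> i)) \<le> (\<Sum>(a, b)\<in>I. norm (y b - y a))" for I
    by (intro sum_mono) auto
  then show ?thesis
    using assms(1) unfolding absolutely_continuous_on_interval_def
    by (meson le_less_trans)
qed

text \<open>Says that the upper derivate of \<open>y\<close> at \<open>x\<close>, taken over intervals around \<open>x\<close>, is at least \<open>q\<close>.
  Bounds on the lower derivate are expressed as \<open>steep (\<lambda>s. - y s) (- p) x\<close>. Since the intervals are
  open around \<open>x\<close>, the set of such \<open>x\<close> is a countable intersection of open sets.\<close>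

definition steep :: "(real \<Rightarrow> real) \<Rightarrow> real \<Rightarrow> real \<Rightarrow> bool" where
  "steep y q x \<longleftrightarrow> (\<forall>h>0. \<exists>a b. a < x \<and> x < b \<and> b - a < h \<and> q * (b - a) < y b - y a)"

lemma steep_mono: "steep y q x \<Longrightarrow> p \<le> q \<Longrightarrow> steep y p x"
  unfolding steep_def
  by (smt (verit, ccfv_threshold) mult_right_mono)

text \<open>The steep intervals around \<open>x\<close> can be taken arbitrarily short, so their
  closures fit into any open neighbourhood. This lets a covering family be placed inside a given
  open set or inside the intervals of another family.\<close>

lemma steep_within:
  assumes "steep y q x" "open G" "x \<in> G" "h > 0"
  shows "\<exists>a b. a < x \<and> x < b \<and> b - a < h \<and> q * (b - a) < y b - y a \<and> {a..b} \<subseteq> G"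
proof -
  obtain r where r: "r > 0" "ball x r \<subseteq> G" using assms openE by blast
  then obtain a b where "a < x" "x < b" "b - a < min h r" "q * (b - a) < y b - y a"
    using assms(1,4) unfolding steep_def by (meson min_less_iff_conj)
  moreover from this have "{a..b} \<subseteq> ball x r" by (auto simp: dist_real_def)
  ultimately show ?thesis using r(2) by (metis min_less_iff_conj order_trans)
qed

lemma borel_steep: "{x. steep y q x} \<in> sets borel"
proof -
  have "{x. steep y q x} = (\<Inter>n. \<Union>(a, b)\<in>{(a, b). b - a < inverse (real (Suc n)) \<and>
      q * (b - a) < y b - y a}. {a<..<b})" (is "?L = ?R")
  proof (intro equalityI subsetI)
    fix x assume x: "x \<in> ?L"
    have "\<exists>a b. a < x \<and> x < b \<and> b - a < inverse (real (Suc n)) \<and> q * (b - a) < y b - y a" for n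
      using x by (simp add: steep_def)
    then show "x \<in> ?R" by fastforce
  next
    fix x assume x: "x \<in> ?R"
    have "\<exists>a b. a < x \<and> x < b \<and> b - a < h \<and> q * (b - a) < y b - y a" if h: "h > 0" for h
    proof -
      obtain n where n: "inverse (real (Suc n)) < h" using reals_Archimedean[OF h] by blast
      from x have "x \<in> (\<Union>(a, b)\<in>{(a, b). b - a < inverse (real (Suc n)) \<and>
        q * (b - a) < y b - y a}. {a<..<b})" by (rule INT_D) simp
      with n show ?thesis by fastforce
    qed
    then show "x \<in> ?L" by (simp add: steep_def)
  qed
  also have "\<dots> \<in> sets borel"
    by (intro sets.countable_INT'' borel_open open_UN) auto
  finally show ?thesis .
qed

text \<open>The intervals of \<open>J\<close> are grouped by the interval of \<open>I\<close> that
  contains them, and \<open>complementary_intervals\<close> is applied to each group. The total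
  length of \<open>K\<close> is then that of \<open>I\<close> minus that of \<open>J\<close>, and
  the increments of every function are accounted for exactly.\<close>

lemma nested_complementary_intervals:
  fixes I J :: "(real \<times> real) set"
  assumes "finite I" "finite J"
    and I: "\<forall>(a, b)\<in>I. a < b" "disjoint_family_on (\<lambda>(a, b). {a<..<b}) I"
    and J: "\<forall>(a, b)\<in>J. a < b" "disjoint_family_on (\<lambda>(a, b). {a<..<b}) J"
    and sub: "\<forall>(c, e)\<in>J. \<exists>(a, b)\<in>I. {c..e} \<subseteq> {a..b}"
  obtains K where "finite K" "\<forall>(c, e)\<in>K. c < e \<and> (\<exists>(a, b)\<in>I. {c..e} \<subseteq> {a..b})"
    "disjoint_family_on (\<lambda>(a, b). {a<..<b}) K"
    "\<And>f :: real \<Rightarrow> real. (\<Sum>(c, e)\<in>J. f e - f c) + (\<Sum>(c, e)\<in>K. f e - f c) = (\<Sum>(a, b)\<in>I. f b - f a)"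
proof -
  define J' where "J' = (\<lambda>(a, b). {(c, e) \<in> J. a \<le> c \<and> e \<le> b})"
  have "\<exists>K. finite K \<and> (\<forall>(c, e)\<in>K. fst i \<le> c \<and> c < e \<and> e \<le> snd i) \<and>
    disjoint_family_on (\<lambda>(c, e). {c<..<e}) K \<and>
    (\<forall>f :: real \<Rightarrow> real. (\<Sum>(c, e)\<in>J' i. f e - f c) + (\<Sum>(c, e)\<in>K. f e - f c) = f (snd i) - f (fst i))"
    if "i \<in> I" for i
  proof (rule complementary_intervals)
    show "finite (J' i)" using \<open>finite J\<close> by (auto simp: J'_def split: prod.splits intro: finite_subset)
    show "disjoint_family_on (\<lambda>(c, e). {c<..<e}) (J' i)"
      using J(2) by (rule disjoint_family_on_mono[rotated]) (auto simp: J'_def split: prod.splits)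
  qed (use that I J in \<open>auto simp: J'_def\<close>)
  then have "\<exists>K. \<forall>i\<in>I. finite (K i) \<and> (\<forall>(c, e)\<in>K i. fst i \<le> c \<and> c < e \<and> e \<le> snd i) \<and>
    disjoint_family_on (\<lambda>(c, e). {c<..<e}) (K i) \<and>
    (\<forall>f :: real \<Rightarrow> real. (\<Sum>(c, e)\<in>J' i. f e - f c) + (\<Sum>(c, e)\<in>K i. f e - f c) = f (snd i) - f (fst i))"
    by (intro bchoice ballI)
  then obtain K where Kall: "\<forall>i\<in>I. finite (K i) \<and> (\<forall>(c, e)\<in>K i. fst i \<le> c \<and> c < e \<and> e \<le> snd i) \<and>
    disjoint_family_on (\<lambda>(c, e). {c<..<e}) (K i) \<and>
    (\<forall>f :: real \<Rightarrow> real. (\<Sum>(c, e)\<in>J' i. f e - f c) + (\<Sum>(c, e)\<in>K i. f e - f c) = f (snd i) - f (fst i))"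
    by (elim exE) (rule that)
  have fin: "\<And>i. i \<in> I \<Longrightarrow> finite (K i)"
    and K: "\<And>i c e. i \<in> I \<Longrightarrow> (c, e) \<in> K i \<Longrightarrow> fst i \<le> c \<and> c < e \<and> e \<le> snd i"
    and disj: "\<And>i. i \<in> I \<Longrightarrow> disjoint_family_on (\<lambda>(c, e). {c<..<e}) (K i)"
    and sum: "\<And>i f :: real \<Rightarrow> real. i \<in> I \<Longrightarrow>
      (\<Sum>(c, e)\<in>J' i. f e - f c) + (\<Sum>(c, e)\<in>K i. f e - f c) = f (snd i) - f (fst i)"
    using Kall by auto
  have sep: "i = j" if "i \<in> I" "j \<in> I" "fst i < z" "z < snd i" "fst j < z" "z < snd j" for i j z
    using I(2) that unfolding disjoint_family_on_def split_beta by fastforce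
  \<comment> \<open>A nondegenerate interval lies in only one member of \<open>I\<close>, since its
    midpoint is interior to that member. Hence the groups are disjoint and the sums over their
    unions split.\<close>
  have sep': "i = j" if "i \<in> I" "j \<in> I" "fst i \<le> c" "c < e" "e \<le> snd i" "fst j \<le> c" "e \<le> snd j" for i j c e
    using sep[of i j "(c + e) / 2"] that by auto
  have J_eq: "J = (\<Union>i\<in>I. J' i)"
  proof
    show "J \<subseteq> (\<Union>i\<in>I. J' i)"
    proof
      fix j assume "j \<in> J"
      then obtain c e a b where "j = (c, e)" "(a, b) \<in> I" "{c..e} \<subseteq> {a..b}" "c < e"
        using sub J(1) by fastforce
      with \<open>j \<in> J\<close> show "j \<in> (\<Union>i\<in>I. J' i)"
        by (intro UN_I[of "(a, b)"]) (auto simp: J'_def)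
    qed
  qed (auto simp: J'_def)
  show ?thesis
  proof (rule that)
    show "finite (\<Union>i\<in>I. K i)" using fin \<open>finite I\<close> by auto
    show "\<forall>(c, e)\<in>\<Union>i\<in>I. K i. c < e \<and> (\<exists>(a, b)\<in>I. {c..e} \<subseteq> {a..b})"
      using K by fastforce
    show "disjoint_family_on (\<lambda>(a, b). {a<..<b}) (\<Union>i\<in>I. K i)"
      unfolding disjoint_family_on_def
    proof (intro ballI impI)
      fix k l assume "k \<in> (\<Union>i\<in>I. K i)" "l \<in> (\<Union>i\<in>I. K i)" "k \<noteq> l"
      then obtain i j where ij: "i \<in> I" "k \<in> K i" "j \<in> I" "l \<in> K j" by blast
      show "(case k of (a, b) \<Rightarrow> {a<..<b}) \<inter> (case l of (a, b) \<Rightarrow> {a<..<b}) = {}"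
      proof (cases "i = j")
        case True
        then show ?thesis using disj ij \<open>k \<noteq> l\<close> unfolding disjoint_family_on_def by blast
      next
        case False
        have "\<not> (fst k < z \<and> z < snd k \<and> fst l < z \<and> z < snd l)" for z
          using sep[OF ij(1,3), of z] K[of i "fst k" "snd k"] K[of j "fst l" "snd l"] ij False by fastforce
        then show ?thesis unfolding split_beta by (intro equals0I) auto
      qed
    qed
    fix f :: "real \<Rightarrow> real"
    have "(\<Sum>(c, e)\<in>J. f e - f c) = (\<Sum>i\<in>I. \<Sum>(c, e)\<in>J' i. f e - f c)"
      unfolding J_eq
    proof (rule sum.UNION_disjoint)
      show "\<forall>i\<in>I. finite (J' i)"
        using \<open>finite J\<close> by (auto simp: J'_def intro: finite_subset)
      show "\<forall>i\<in>I. \<forall>j\<in>I. i \<noteq> j \<longrightarrow> J' i \<inter> J' j = {}"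
        using sep' J(1) by (fastforce simp: J'_def)
    qed fact
    moreover have "(\<Sum>(c, e)\<in>(\<Union>i\<in>I. K i). f e - f c) = (\<Sum>i\<in>I. \<Sum>(c, e)\<in>K i. f e - f c)"
    proof (rule sum.UNION_disjoint)
      show "\<forall>i\<in>I. \<forall>j\<in>I. i \<noteq> j \<longrightarrow> K i \<inter> K j = {}"
        using sep' K by (smt (verit, best) disjoint_iff prod.collapse)
    qed (use fin \<open>finite I\<close> in auto)
    ultimately show "(\<Sum>(c, e)\<in>J. f e - f c) + (\<Sum>(c, e)\<in>(\<Union>i\<in>I. K i). f e - f c) = (\<Sum>(a, b)\<in>I. f b - f a)"
      using sum by (simp add: sum.distrib[symmetric] split_beta)
  qed
qed

text \<open>The intervals in \<open>steep\<close> have \<open>x\<close> strictly inside. Letting one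
  end point tend to \<open>x\<close> and using continuity extends the slope bound to intervals that
  have \<open>x\<close> as an end point, the form needed for difference quotients.\<close>

lemma not_steepE:
  assumes cont: "isCont y x" and ns: "\<not> steep y q x"
  obtains h where "h > 0" "\<And>a b. a \<le> x \<Longrightarrow> x \<le> b \<Longrightarrow> b - a < h \<Longrightarrow> y b - y a \<le> q * (b - a)"
proof -
  obtain h where "h > 0" and h: "\<And>a b. a < x \<Longrightarrow> x < b \<Longrightarrow> b - a < h \<Longrightarrow> y b - y a \<le> q * (b - a)"
    using ns unfolding steep_def by (meson not_less)
  have left: "y b - y x \<le> q * (b - x)" if "x < b" "b - x < h" for b
  proof (rule tendsto_le)
    show "((\<lambda>a. q * (b - a)) \<longlongrightarrow> q * (b - x)) (at_left x)" by (intro tendsto_intros)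
    show "((\<lambda>a. y b - y a) \<longlongrightarrow> y b - y x) (at_left x)"
      using cont by (intro tendsto_intros) (simp add: isCont_def filterlim_at_split)
    have "eventually (\<lambda>a. a \<in> {b - h<..<x}) (at_left x)"
      using that by (intro eventually_at_left_real) auto
    then show "eventually (\<lambda>a. y b - y a \<le> q * (b - a)) (at_left x)"
      by eventually_elim (use h that in auto)
  qed simp
  have right: "y x - y a \<le> q * (x - a)" if "a < x" "x - a < h" for a
  proof (rule tendsto_le)
    show "((\<lambda>b. q * (b - a)) \<longlongrightarrow> q * (x - a)) (at_right x)" by (intro tendsto_intros)
    show "((\<lambda>b. y b - y a) \<longlongrightarrow> y x - y a) (at_right x)"
      using cont by (intro tendsto_intros) (simp add: isCont_def filterlim_at_split)
    have "eventually (\<lambda>b. b \<in> {x<..<a + h}) (at_right x)"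
      using that by (intro eventually_at_right_real) auto
    then show "eventually (\<lambda>b. y b - y a \<le> q * (b - a)) (at_right x)"
      by eventually_elim (use h that in auto)
  qed simp
  have "y b - y a \<le> q * (b - a)" if "a \<le> x" "x \<le> b" "b - a < h" for a b
    using that h[of a b] left[of b] right[of a] by (cases "a = x"; cases "b = x") auto
  with \<open>h > 0\<close> show ?thesis by (rule that)
qed

text \<open>\<open>up\<close> and \<open>down\<close> make both derivates finite, and
  \<open>cross\<close> leaves no gap between them. The derivative is the supremum of
  \<open>P\<close>, the slopes that bound the increments over all short intervals around
  \<open>x\<close> from below.\<close>

lemma differentiable_if_not_steep:
  assumes cont: "isCont y x"
    and up: "\<not> steep y q0 x" and down: "\<not> steep (\<lambda>s. - y s) q1 x"
    and cross: "\<And>p q. p < q \<Longrightarrow> \<not> (steep y q x \<and> steep (\<lambda>s. - y s) (- p) x)"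
  shows "y differentiable (at x)"
proof -
  have cont': "isCont (\<lambda>s. - y s) x" using cont by (intro continuous_intros)
  define P where "P = {p. \<not> steep (\<lambda>s. - y s) (- p) x}"
  define c where "c = Sup P"
  have "- q1 \<in> P" using down by (simp add: P_def)
  have bdd: "p \<le> q0" if "p \<in> P" for p
  proof -
    have steep_p: "\<not> steep (\<lambda>s. - y s) (- p) x" using that by (simp add: P_def)
    obtain h where h: "h > 0" "\<And>a b. a \<le> x \<Longrightarrow> x \<le> b \<Longrightarrow> b - a < h \<Longrightarrow> y b - y a \<le> q0 * (b - a)"
      using not_steepE[OF cont up] by metis
    obtain k where k: "k > 0" "\<And>a b. a \<le> x \<Longrightarrow> x \<le> b \<Longrightarrow> b - a < k \<Longrightarrow> - y b - - y a \<le> - p * (b - a)"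
      using not_steepE[OF cont' steep_p] by metis
    define b where "b = x + min h k / 2"
    have b: "b - x > 0" "b - x < h" "b - x < k" using h(1) k(1) by (auto simp: b_def min_def)
    then have "p * (b - x) \<le> q0 * (b - x)"
      using h(2)[of x b] k(2)[of x b] by linarith
    with b(1) show ?thesis by simp
  qed
  have "(y has_derivative (\<lambda>z. c * z)) (at x)"
    unfolding has_derivative_at_alt
  proof (intro conjI allI impI)
    show "bounded_linear (\<lambda>z. c * z)" by (rule bounded_linear_mult_right)
    fix e :: real assume "e > 0"
    obtain p where p: "p \<in> P" "c - e < p"
      using less_cSup_iff[of P "c - e"] \<open>- q1 \<in> P\<close> bdd \<open>e > 0\<close>
      by (auto simp: c_def bdd_above_def)
    \<comment> \<open>\<open>c + e / 2\<close> fails as a lower slope, so \<open>cross\<close>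
      excludes steepness with slope \<open>c + e\<close>; halving \<open>e\<close> provides the
      strict inequality in \<open>cross\<close>.\<close>
    have "c + e / 2 \<notin> P"
      using cSup_upper[of "c + e / 2" P] bdd \<open>e > 0\<close> by (auto simp: c_def bdd_above_def)
    then have "\<not> steep y (c + e) x"
      using cross[of "c + e / 2" "c + e"] \<open>e > 0\<close> by (auto simp: P_def)
    then obtain h where h: "h > 0" "\<And>a b. a \<le> x \<Longrightarrow> x \<le> b \<Longrightarrow> b - a < h \<Longrightarrow> y b - y a \<le> (c + e) * (b - a)"
      using not_steepE[OF cont] by metis
    have steep_p: "\<not> steep (\<lambda>s. - y s) (- p) x" using p(1) by (simp add: P_def)
    obtain k where k: "k > 0" "\<And>a b. a \<le> x \<Longrightarrow> x \<le> b \<Longrightarrow> b - a < k \<Longrightarrow> - y b - - y a \<le> - p * (b - a)"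
      using not_steepE[OF cont' steep_p] by metis
    have lower: "(c - e) * (b - a) \<le> y b - y a" if "a \<le> x" "x \<le> b" "b - a < k" for a b
      using k(2)[OF that] mult_right_mono[of "c - e" p "b - a"] p(2) that by simp
    show "\<exists>d>0. \<forall>z. norm (z - x) < d \<longrightarrow> norm (y z - y x - c * (z - x)) \<le> e * norm (z - x)"
    proof (intro exI[of _ "min h k"] conjI allI impI)
      fix z assume z: "norm (z - x) < min h k"
      show "norm (y z - y x - c * (z - x)) \<le> e * norm (z - x)"
      proof (cases "z \<le> x")
        case True
        then have "y x - y z \<le> (c + e) * (x - z)" "(c - e) * (x - z) \<le> y x - y z"
          using z by (auto intro!: h(2) lower)
        then show ?thesis using True by (simp add: abs_le_iff algebra_simps)
      next
        case False
        then have "y z - y x \<le> (c + e) * (z - x)" "(c - e) * (z - x) \<le> y z - y x"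
          using z by (auto intro!: h(2) lower)
        then show ?thesis using False by (simp add: abs_le_iff algebra_simps)
      qed
    qed (use h(1) k(1) in auto)
  qed
  then show ?thesis unfolding differentiable_def by blast
qed

lemma lmeasurable_steep:
  "{x \<in> {t<..<T}. steep y q x \<and> steep z r x} \<in> lmeasurable"
proof -
  have "{x. steep y q x} \<inter> {x. steep z r x} \<in> sets lebesgue"
    using borel_steep by (intro sets.Int) (auto simp: sets_completionI_sets)
  then have "{t<..<T} \<inter> ({x. steep y q x} \<inter> {x. steep z r x}) \<in> lmeasurable"
    by (intro fmeasurable_Int_fmeasurable) auto
  then show ?thesis by (rule back_subst[of "\<lambda>S. S \<in> lmeasurable"]) auto
qed

lemma lmeasurable_Union_intervals:
  fixes I :: "(real \<times> real) set"
  assumes "finite I"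
  shows "(\<Union>(a, b)\<in>I. {a<..<b}) \<in> lmeasurable"
  using assms by (intro fmeasurable.finite_UN) auto

lemma lmeasurable_outer_open_within:
  fixes S :: "real set"
  assumes "S \<in> lmeasurable" "S \<subseteq> {t<..<T}" "e > 0"
  obtains G where "open G" "S \<subseteq> G" "G \<subseteq> {t<..<T}" "measure lebesgue G < measure lebesgue S + e"
proof -
  obtain G where G: "open G" "S \<subseteq> G" "G - S \<in> lmeasurable" "emeasure lebesgue (G - S) < ennreal e"
    using sets_lebesgue_outer_open[of S e] assms by (auto intro: fmeasurableD)
  then have "measure lebesgue (G - S) < e"
    using \<open>e > 0\<close> by (simp add: emeasure_eq_measure2 ennreal_less_iff)
  moreover have "measure lebesgue (G \<inter> {t<..<T}) \<le> measure lebesgue (S \<union> (G - S))"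
  proof (rule measure_mono_fmeasurable)
    show "G \<inter> {t<..<T} \<in> sets lebesgue" using G(1) by (auto intro!: borel_open sets_completionI_sets)
    show "S \<union> (G - S) \<in> lmeasurable" using assms(1) G(3) by (rule fmeasurable.Un)
  qed auto
  moreover have "measure lebesgue (S \<union> (G - S)) \<le> measure lebesgue S + measure lebesgue (G - S)"
    using assms G by (intro measure_Un_le) (auto simp: fmeasurableD)
  ultimately show ?thesis
    using assms G by (intro that[of "G \<inter> {t<..<T}"]) auto
qed

text \<open>Cover the set by intervals \<open>I\<close> of slope less than \<open>p\<close>, and again by intervals \<open>J\<close> of slope greater than \<open>q\<close>
  inside \<open>I\<close>. The increments of \<open>y\<close> over \<open>I\<close> and over \<open>J\<close> differ by the increments over a family of
  small total length, which absolute continuity makes negligible.\<close>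

lemma negligible_steep_cross:
  assumes ac: "absolutely_continuous_on_interval t T y" and "p < q"
  shows "negligible {x \<in> {t<..<T}. steep y q x \<and> steep (\<lambda>s. - y s) (- p) x}" (is "negligible ?S")
proof (rule ccontr)
  assume "\<not> negligible ?S"
  define S where "S = ?S"
  define m where "m = measure lebesgue S"
  have lm: "S \<in> lmeasurable" unfolding S_def by (rule lmeasurable_steep)
  have "m > 0" using \<open>\<not> negligible ?S\<close> lm by (simp add: m_def S_def zero_less_measure_iff negligible_iff_measure0)
  \<comment> \<open>The estimates below combine to \<open>(q - p) * (m - 2 * \<epsilon>) < (3 *
    \<bar>p\<bar> + 1) * \<epsilon>\<close>. \<open>C\<close> collects the coefficients of
    \<open>\<epsilon>\<close>, and \<open>\<epsilon>\<close> is chosen so that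
    \<open>C * \<epsilon>\<close> is half of \<open>(q - p) * m\<close>.\<close>
  define C where "C = 3 * \<bar>p\<bar> + 1 + 2 * (q - p)"
  have "C > 0" using \<open>p < q\<close> by (simp add: C_def)
  define \<epsilon> where "\<epsilon> = (q - p) * m / (2 * C)"
  have "\<epsilon> > 0" using \<open>p < q\<close> \<open>m > 0\<close> \<open>C > 0\<close> by (simp add: \<epsilon>_def)
  obtain \<delta> where "\<delta> > 0" and \<delta>:
    "\<And>I. nonoverlapping_in t T I \<Longrightarrow> (\<Sum>(a, b)\<in>I. b - a) < \<delta> \<Longrightarrow> (\<Sum>(a, b)\<in>I. norm (y b - y a)) < \<epsilon>"
    using absolutely_continuous_on_intervalD[OF ac \<open>\<epsilon> > 0\<close>] by metis
  \<comment> \<open>The open set \<open>G\<close> and the two coverings cost \<open>e\<close> each,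
    so \<open>K\<close> gets total length at most \<open>3 * e\<close>, which has to stay below
    \<open>\<delta>\<close>.\<close>
  define e where "e = min \<epsilon> (\<delta> / 4)"
  have e: "e > 0" "e \<le> \<epsilon>" "3 * e < \<delta>" using \<open>\<epsilon> > 0\<close> \<open>\<delta> > 0\<close> by (auto simp: e_def)
  obtain G where G: "open G" "S \<subseteq> G" "G \<subseteq> {t<..<T}" "measure lebesgue G < m + e"
    using lmeasurable_outer_open_within[OF lm, of t T e] e unfolding m_def S_def by blast
  have "\<exists>a b. a < x \<and> x < b \<and> b - a < h \<and> {a..b} \<subseteq> G \<and> y b - y a < p * (b - a)" if x: "x \<in> S" and h: "h > 0" for x h
  proof -
    have "steep (\<lambda>s. - y s) (- p) x" "x \<in> G" using x G(2) by (auto simp: S_def)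
    then obtain a b where "a < x" "x < b" "b - a < h" "- p * (b - a) < - y b - - y a" "{a..b} \<subseteq> G"
      using steep_within[OF _ G(1) _ h] by metis
    then show ?thesis by (intro exI[of _ a] exI[of _ b]) auto
  qed
  then obtain I where I: "finite I" "\<forall>(a, b)\<in>I. a < b \<and> {a..b} \<subseteq> G \<and> y b - y a < p * (b - a)"
    "disjoint_family_on (\<lambda>(a, b). {a<..<b}) I"
    "measure lebesgue S - e < measure lebesgue (S \<inter> (\<Union>(a, b)\<in>I. {a<..<b}))"
    by (rule Vitali_finite_intervals[OF lm \<open>e > 0\<close>])
  \<comment> \<open>Only points already covered by \<open>I\<close> enter the second covering, so
    its intervals can be chosen inside those of \<open>I\<close>.\<close>
  define S' where "S' = S \<inter> (\<Union>(a, b)\<in>I. {a<..<b})"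
  have lm': "S' \<in> lmeasurable"
    unfolding S'_def using lm I(1)
    by (intro fmeasurable_Int_fmeasurable fmeasurableD lmeasurable_Union_intervals)
  have "\<exists>c e. c < x \<and> x < e \<and> e - c < h \<and> (\<exists>(a, b)\<in>I. {c..e} \<subseteq> {a<..<b}) \<and> q * (e - c) < y e - y c"
    if x: "x \<in> S'" and h: "h > 0" for x h
  proof -
    obtain a b where ab: "(a, b) \<in> I" "x \<in> {a<..<b}" using x by (auto simp: S'_def)
    have "steep y q x" using x by (auto simp: S'_def S_def)
    then obtain c e where "c < x" "x < e" "e - c < h" "q * (e - c) < y e - y c" "{c..e} \<subseteq> {a<..<b}"
      using steep_within[OF _ open_greaterThanLessThan ab(2) h] by metis
    with ab(1) show ?thesis by (intro exI[of _ c] exI[of _ e] conjI bexI[of _ "(a, b)"]) auto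
  qed
  then obtain J where J: "finite J"
    "\<forall>(c, e)\<in>J. c < e \<and> (\<exists>(a, b)\<in>I. {c..e} \<subseteq> {a<..<b}) \<and> q * (e - c) < y e - y c"
    "disjoint_family_on (\<lambda>(a, b). {a<..<b}) J"
    "measure lebesgue S' - e < measure lebesgue (S' \<inter> (\<Union>(a, b)\<in>J. {a<..<b}))"
    by (rule Vitali_finite_intervals[OF lm' \<open>e > 0\<close>])
  have I': "\<forall>(a, b)\<in>I. a < b" using I(2) by auto
  have J': "\<forall>(a, b)\<in>J. a < b" using J(2) by auto
  have JI: "\<forall>(c, e)\<in>J. \<exists>(a, b)\<in>I. {c..e} \<subseteq> {a..b}"
  proof clarify
    fix c e assume "(c, e) \<in> J"
    then have "\<exists>(a, b)\<in>I. {c..e} \<subseteq> {a<..<b}" using J(2) by blast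
    then obtain a b where "(a, b) \<in> I" "{c..e} \<subseteq> {a<..<b}" by blast
    then show "\<exists>(a, b)\<in>I. {c..e} \<subseteq> {a..b}"
      by (intro bexI[of _ "(a, b)"]) (auto simp: subset_iff)
  qed
  obtain K where K: "finite K" "\<forall>(c, e)\<in>K. c < e \<and> (\<exists>(a, b)\<in>I. {c..e} \<subseteq> {a..b})"
    "disjoint_family_on (\<lambda>(a, b). {a<..<b}) K"
    and sums: "\<And>f :: real \<Rightarrow> real.
      (\<Sum>(c, e)\<in>J. f e - f c) + (\<Sum>(c, e)\<in>K. f e - f c) = (\<Sum>(a, b)\<in>I. f b - f a)"
    by (rule nested_complementary_intervals[OF I(1) J(1) I' I(3) J' J(3) JI]) (rule that; assumption)
  have "(\<Sum>(a, b)\<in>I. b - a) = measure lebesgue (\<Union>(a, b)\<in>I. {a<..<b})"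
    using I' by (intro sum_interval_lengths[OF I(1,3), symmetric]) auto
  also have "\<dots> \<le> measure lebesgue G"
  proof (rule measure_mono_fmeasurable)
    have "{a<..<b} \<subseteq> G" if "(a, b) \<in> I" for a b
      using I(2) that greaterThanLessThan_subseteq_atLeastAtMost_iff[of a b a b] by blast
    then show "(\<Union>(a, b)\<in>I. {a<..<b}) \<subseteq> G" by blast
    show "G \<in> lmeasurable"
      using G(1,3) bounded_subset[OF bounded_box, of G t T] by (simp add: lmeasurable_open)
  qed (use I(1) in \<open>intro fmeasurableD lmeasurable_Union_intervals\<close>)
  finally have lenI: "(\<Sum>(a, b)\<in>I. b - a) < m + e" using G by simp
  have "m - 2 * e < measure lebesgue (S' \<inter> (\<Union>(a, b)\<in>J. {a<..<b}))"
    using I(4) J(4) by (simp add: S'_def m_def)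
  also have "\<dots> \<le> measure lebesgue (\<Union>(a, b)\<in>J. {a<..<b})"
    using J(1) lm' by (intro measure_mono_fmeasurable lmeasurable_Union_intervals sets.Int fmeasurableD) auto
  also have "\<dots> = (\<Sum>(a, b)\<in>J. b - a)"
    using J' by (intro sum_interval_lengths[OF J(1,3)]) auto
  finally have lenJ: "m - 2 * e < (\<Sum>(a, b)\<in>J. b - a)" .
  have lenK: "(\<Sum>(a, b)\<in>K. b - a) \<le> 3 * e"
    using sums[of "\<lambda>x. x"] lenI lenJ by simp
  have K0: "0 \<le> (\<Sum>(a, b)\<in>K. b - a)"
    using K(2) by (intro sum_nonneg) auto
  have "t \<le> c \<and> c \<le> e \<and> e \<le> T" if "(c, e) \<in> K" for c e
  proof -
    have "\<exists>(a, b)\<in>I. {c..e} \<subseteq> {a..b}" and "c < e" using K(2) that by auto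
    then obtain a b where ab: "(a, b) \<in> I" "{c..e} \<subseteq> {a..b}" by blast
    then have "{a..b} \<subseteq> {t<..<T}" using I(2) G(3) by blast
    then have "{c..e} \<subseteq> {t<..<T}" using ab(2) by blast
    then have "c \<in> {t<..<T}" "e \<in> {t<..<T}" 
      using \<open>c < e\<close> by (meson atLeastAtMost_iff less_imp_le order_refl subsetD)+
    with \<open>c < e\<close> show ?thesis by simp
  qed
  then have "nonoverlapping_in t T K"
    unfolding nonoverlapping_in_def using K(1,3) by blast
  then have "(\<Sum>(a, b)\<in>K. norm (y b - y a)) < \<epsilon>"
    using \<delta> lenK e by simp
  then have yK: "- \<epsilon> < (\<Sum>(a, b)\<in>K. y b - y a)"
    using sum_abs[of "\<lambda>(a, b). y b - y a" K] unfolding split_beta real_norm_def by linarith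
  have "(\<Sum>(a, b)\<in>I. y b - y a) \<le> (\<Sum>(a, b)\<in>I. p * (b - a))"
    using I(2) by (intro sum_mono) (auto simp: less_imp_le)
  moreover have "(\<Sum>(a, b)\<in>J. q * (b - a)) \<le> (\<Sum>(a, b)\<in>J. y b - y a)"
    using J(2) by (intro sum_mono) (auto simp: less_imp_le)
  ultimately have "q * (\<Sum>(a, b)\<in>J. b - a) \<le> p * ((\<Sum>(a, b)\<in>J. b - a) + (\<Sum>(a, b)\<in>K. b - a)) + \<epsilon>"
    using yK sums[of y] sums[of "\<lambda>x. x"] by (simp add: sum_distrib_left[symmetric] split_beta)
  moreover have "p * (\<Sum>(a, b)\<in>K. b - a) \<le> \<bar>p\<bar> * (3 * \<epsilon>)"
    using mult_right_mono[OF abs_ge_self[of p] K0] mult_left_mono[of "\<Sum>(a, b)\<in>K. b - a" "3 * \<epsilon>" "\<bar>p\<bar>"] lenK e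
    by linarith
  ultimately have "(q - p) * (\<Sum>(a, b)\<in>J. b - a) \<le> (3 * \<bar>p\<bar> + 1) * \<epsilon>"
    by (simp add: algebra_simps)
  moreover have "(q - p) * (m - 2 * \<epsilon>) < (q - p) * (\<Sum>(a, b)\<in>J. b - a)"
    using lenJ e \<open>p < q\<close> by (intro mult_strict_left_mono) auto
  ultimately have "(q - p) * m < C * \<epsilon>" by (simp add: C_def algebra_simps)
  also have "\<dots> = (q - p) * m / 2" using \<open>C > 0\<close> by (simp add: \<epsilon>_def)
  finally show False using \<open>p < q\<close> \<open>m > 0\<close> by simp
qed

text \<open>If the part in a small ball had positive measure \<open>m\<close>, disjoint intervals of
  slope above \<open>4 / m\<close> would cover more than half of it, and the increments of
  \<open>y\<close> over them would exceed \<open>2\<close>. The radius \<open>\<delta> / 4\<close>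
  keeps their total length below \<open>\<delta>\<close>, where absolute continuity allows less than
  \<open>1\<close>. Local negligibility then gives the whole set.\<close>

lemma negligible_steep_all:
  assumes ac: "absolutely_continuous_on_interval t T y"
  shows "negligible {x \<in> {t<..<T}. \<forall>q. steep y q x}" (is "negligible ?S")
proof -
  obtain \<delta> where "\<delta> > 0" and \<delta>:
    "\<And>I. nonoverlapping_in t T I \<Longrightarrow> (\<Sum>(a, b)\<in>I. b - a) < \<delta> \<Longrightarrow> (\<Sum>(a, b)\<in>I. norm (y b - y a)) < 1"
    using absolutely_continuous_on_intervalD[OF ac zero_less_one] by metis
  have "negligible (?S \<inter> ball x (\<delta> / 4))" for x
  proof (rule ccontr)
    assume nonnull: "\<not> negligible (?S \<inter> ball x (\<delta> / 4))"
    define S where "S = ?S \<inter> ball x (\<delta> / 4)"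
    define m where "m = measure lebesgue S"
    define G where "G = {t<..<T} \<inter> ball x (\<delta> / 4)"
    have "open G" by (auto simp: G_def)
    have "{x. \<forall>q. steep y q x} = (\<Inter>n. {x. steep y (real n) x})"
      using real_arch_simple by (auto intro: steep_mono)
    also have "\<dots> \<in> sets borel"
      by (intro sets.countable_INT'' borel_steep) auto
    finally have "({t<..<T} \<inter> ball x (\<delta> / 4)) \<inter> {x. \<forall>q. steep y q x} \<in> lmeasurable"
      by (intro fmeasurable_Int_fmeasurable sets_completionI_sets) auto
    then have lm: "S \<in> lmeasurable"
      by (rule back_subst[of "\<lambda>S. S \<in> lmeasurable"]) (auto simp: S_def)
    then have "m > 0"
      using nonnull by (simp add: m_def S_def zero_less_measure_iff negligible_iff_measure0)
    then have "m / 2 > 0" by simp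
    have "\<exists>a b. a < z \<and> z < b \<and> b - a < h \<and> {a..b} \<subseteq> G \<and> 4 / m * (b - a) < y b - y a"
      if z: "z \<in> S" and h: "h > 0" for z h
    proof -
      have "steep y (4 / m) z" "z \<in> G" using z by (auto simp: S_def G_def)
      then show ?thesis
        using steep_within[OF _ \<open>open G\<close> _ h] by metis
    qed
    then obtain I where I: "finite I" "\<forall>(a, b)\<in>I. a < b \<and> {a..b} \<subseteq> G \<and> 4 / m * (b - a) < y b - y a"
      "disjoint_family_on (\<lambda>(a, b). {a<..<b}) I"
      "measure lebesgue S - m / 2 < measure lebesgue (S \<inter> (\<Union>(a, b)\<in>I. {a<..<b}))"
      by (rule Vitali_finite_intervals[OF lm \<open>m / 2 > 0\<close>])
    have G: "t \<le> a" "a \<le> b" "b \<le> T" "{a<..<b} \<subseteq> ball x (\<delta> / 4)" if "(a, b) \<in> I" for a b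
    proof -
      have "a < b" "{a..b} \<subseteq> G" using I(2) that by auto
      then have "a \<in> G" "b \<in> G" by (meson atLeastAtMost_iff less_imp_le order_refl subsetD)+
      then show "t \<le> a" "b \<le> T" by (auto simp: G_def)
      show "a \<le> b" using \<open>a < b\<close> by simp
      have "{a<..<b} \<subseteq> {a..b}" by auto
      with \<open>{a..b} \<subseteq> G\<close> show "{a<..<b} \<subseteq> ball x (\<delta> / 4)" by (auto simp: G_def)
    qed
    have len: "(\<Sum>(a, b)\<in>I. b - a) = measure lebesgue (\<Union>(a, b)\<in>I. {a<..<b})"
      using G by (intro sum_interval_lengths[OF I(1,3), symmetric]) auto
    have "m / 2 < measure lebesgue (S \<inter> (\<Union>(a, b)\<in>I. {a<..<b}))"
      using I(4) by (simp add: m_def)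
    also have "\<dots> \<le> measure lebesgue (\<Union>(a, b)\<in>I. {a<..<b})"
      using I(1) lm by (intro measure_mono_fmeasurable lmeasurable_Union_intervals sets.Int fmeasurableD) auto
    finally have lower: "m / 2 < (\<Sum>(a, b)\<in>I. b - a)" by (simp add: len)
    have "measure lebesgue (\<Union>(a, b)\<in>I. {a<..<b}) \<le> measure lebesgue (ball x (\<delta> / 4))"
    proof (rule measure_mono_fmeasurable)
      show "(\<Union>(a, b)\<in>I. {a<..<b}) \<subseteq> ball x (\<delta> / 4)" using G(4) by blast
    qed (use I(1) in \<open>auto intro!: fmeasurableD lmeasurable_Union_intervals\<close>)
    also have "\<dots> = \<delta> / 2" using \<open>\<delta> > 0\<close> by (simp add: ball_eq_greaterThanLessThan)
    also have "\<dots> < \<delta>" using \<open>\<delta> > 0\<close> by simp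
    finally have "(\<Sum>(a, b)\<in>I. b - a) < \<delta>" by (simp add: len)
    moreover have "nonoverlapping_in t T I"
      unfolding nonoverlapping_in_def using I(1,3) G(1,2,3) by blast
    ultimately have "(\<Sum>(a, b)\<in>I. norm (y b - y a)) < 1"
      using \<delta> by blast
    moreover have "(\<Sum>(a, b)\<in>I. y b - y a) \<le> (\<Sum>(a, b)\<in>I. norm (y b - y a))"
      by (intro sum_mono) auto
    moreover have "(\<Sum>(a, b)\<in>I. 4 / m * (b - a)) \<le> (\<Sum>(a, b)\<in>I. y b - y a)"
      using I(2) by (intro sum_mono) (auto simp: less_imp_le)
    moreover have "(\<Sum>(a, b)\<in>I. 4 / m * (b - a)) = 4 / m * (\<Sum>(a, b)\<in>I. b - a)"
      unfolding sum_distrib_left by (intro sum.cong) auto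
    moreover have "4 / m * (m / 2) < 4 / m * (\<Sum>(a, b)\<in>I. b - a)"
      using lower \<open>m > 0\<close> by (intro mult_strict_left_mono) auto
    ultimately have "4 / m * (m / 2) < 1" by linarith
    then show False using \<open>m > 0\<close> by simp
  qed
  moreover have "openin (top_of_set ?S) (?S \<inter> ball x (\<delta> / 4))" for x
    by (rule openin_open_Int) simp
  moreover have "x \<in> ball x (\<delta> / 4)" for x using \<open>\<delta> > 0\<close> by simp
  ultimately show ?thesis
    unfolding locally_negligible_alt[of ?S] by blast
qed

section \<open>Differentiability almost everywhere and the fundamental theorem of calculus\<close>

lemma absolutely_continuous_minus:
  "absolutely_continuous_on_interval t T y \<Longrightarrow> absolutely_continuous_on_interval t T (\<lambda>s. - y s)"
  unfolding absolutely_continuous_on_interval_def minus_diff_minus norm_minus_cancel .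

text \<open>Where the derivative fails to exist, either a gap between the derivates contains two
  rationals, a case for \<open>negligible_steep_cross\<close>, or a derivate is infinite, a case for
  \<open>negligible_steep_all\<close> with \<open>y\<close> or \<open>- y\<close>. Only countably
  many rational pairs occur.\<close>

lemma absolutely_continuous_differentiable_ae_real:
  fixes y :: "real \<Rightarrow> real"
  assumes ac: "absolutely_continuous_on_interval t T y"
  shows "negligible {x \<in> {t<..<T}. \<not> y differentiable (at x)}"
proof -
  define X where "X r = {x \<in> {t<..<T}. steep y (snd r) x \<and> steep (\<lambda>s. - y s) (- fst r) x}" for r :: "real \<times> real"
  define R where "R = {r \<in> \<rat> \<times> \<rat>. fst r < (snd r :: real)}"
  have "countable R"
    unfolding R_def by (rule countable_subset[of _ "\<rat> \<times> \<rat>"]) (auto intro: countable_rat)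
  moreover have "negligible (X r)" if "r \<in> R" for r
    unfolding X_def by (rule negligible_steep_cross[OF ac]) (use that in \<open>simp add: R_def\<close>)
  ultimately have "negligible (\<Union> (X ` R))"
    by (intro negligible_countable_Union) auto
  moreover note negligible_steep_all[OF ac] negligible_steep_all[OF absolutely_continuous_minus[OF ac]]
  ultimately have "negligible (\<Union> (X ` R) \<union> {x \<in> {t<..<T}. \<forall>q. steep y q x} \<union>
      {x \<in> {t<..<T}. \<forall>q. steep (\<lambda>s. - y s) q x})"
    by (intro negligible_Un)
  then show ?thesis
  proof (rule negligible_subset, intro subsetI)
    fix x assume x: "x \<in> {x \<in> {t<..<T}. \<not> y differentiable (at x)}"
    show "x \<in> \<Union> (X ` R) \<union> {x \<in> {t<..<T}. \<forall>q. steep y q x} \<union>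
      {x \<in> {t<..<T}. \<forall>q. steep (\<lambda>s. - y s) q x}"
    proof (rule ccontr)
      assume nx: "\<not> ?thesis"
      have cont: "isCont y x"
        using x absolutely_continuous_imp_continuous_on[OF ac]
        by (metis (mono_tags, lifting) continuous_on_interior interior_atLeastAtMost_real mem_Collect_eq)
      obtain q0 where q0: "\<not> steep y q0 x" using x nx by blast
      obtain q1 where q1: "\<not> steep (\<lambda>s. - y s) q1 x" using x nx by blast
      have "\<not> (steep y q x \<and> steep (\<lambda>s. - y s) (- p) x)" if pq: "p < q" for p q
      proof
        assume *: "steep y q x \<and> steep (\<lambda>s. - y s) (- p) x"
        obtain p' where p': "p' \<in> \<rat>" "p < p'" "p' < q" using Rats_dense_in_real[OF pq] by blast
        obtain q' where q': "q' \<in> \<rat>" "p' < q'" "q' < q" using Rats_dense_in_real[OF p'(3)] by blast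
        have "steep y q' x" "steep (\<lambda>s. - y s) (- p') x"
          using * p' q' by (auto elim!: steep_mono)
        then have "x \<in> X (p', q')" "(p', q') \<in> R" using x p' q' by (auto simp: X_def R_def)
        then show False using nx by blast
      qed
      then have "y differentiable (at x)"
        using differentiable_if_not_steep[OF cont q0 q1] by blast
      then show False using x by blast
    qed
  qed
qed

lemma absolutely_continuous_differentiable_ae:
  fixes y :: "real \<Rightarrow> 'a::euclidean_space"
  assumes ac: "absolutely_continuous_on_interval t T y"
  shows "negligible {x \<in> {t..T}. \<not> y differentiable (at x within {t..T})}"
proof -
  have "negligible (\<Union>i\<in>Basis. {x \<in> {t<..<T}. \<not> (\<lambda>s. y s \<bullet> i) differentiable (at x)})"
  proof (intro negligible_countable_Union countable_image countable_finite finite_Basis, elim imageE)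
    fix S and i :: 'a assume "S = {x \<in> {t<..<T}. \<not> (\<lambda>s. y s \<bullet> i) differentiable (at x)}" "i \<in> Basis"
    moreover from this(2) have "absolutely_continuous_on_interval t T (\<lambda>s. y s \<bullet> i)"
      by (intro absolutely_continuous_on_interval_inner[OF ac]) simp
    ultimately show "negligible S"
      using absolutely_continuous_differentiable_ae_real by blast
  qed
  \<comment> \<open>The scalar result concerns the open interval, so the two end points are added to
    the exceptional set.\<close>
  then have "negligible ((\<Union>i\<in>Basis. {x \<in> {t<..<T}. \<not> (\<lambda>s. y s \<bullet> i) differentiable (at x)}) \<union> {t, T})"
    by (intro negligible_Un) auto
  then show ?thesis
  proof (rule negligible_subset, intro subsetI)
    fix x assume x: "x \<in> {x \<in> {t..T}. \<not> y differentiable (at x within {t..T})}"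
    then have "\<not> y differentiable (at x)"
      using differentiable_at_withinI by blast
    then have "\<exists>i\<in>Basis. \<not> (\<lambda>s. y s \<bullet> i) differentiable (at x)"
      using differentiable_componentwise_within[of y x UNIV] by blast
    then show "x \<in> (\<Union>i\<in>Basis. {x \<in> {t<..<T}. \<not> (\<lambda>s. y s \<bullet> i) differentiable (at x)}) \<union> {t, T}"
      using x by auto
  qed
qed

text \<open>In a Riemann sum, the tags at which \<open>y\<close> is not differentiable sit in intervals contained in an
  open set of small measure; there the increments of \<open>y\<close> are small by absolute continuity.\<close>

theorem absolutely_continuous_has_integral_vector_derivative:
  fixes y :: "real \<Rightarrow> 'a::euclidean_space"
  assumes ac: "absolutely_continuous_on_interval t T y" and "t \<le> T"
  shows "((\<lambda>s. vector_derivative y (at s within {t..T})) has_integral (y T - y t)) {t..T}"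
proof -
  define N where "N = {x \<in> {t..T}. \<not> y differentiable (at x within {t..T})}"
  \<comment> \<open>The value \<open>0\<close> on \<open>N\<close> reduces the error at a tag in
    \<open>N\<close> to an increment of \<open>y\<close>.\<close>
  define f where "f s = (if s \<in> N then 0 else vector_derivative y (at s within {t..T}))" for s
  have "negligible N" unfolding N_def by (rule absolutely_continuous_differentiable_ae[OF ac])
  have "(f has_integral (y T - y t)) {t..T}"
    unfolding has_integral_real
  proof (intro allI impI)
    fix e :: real assume "e > 0"
    then have "e / 2 > 0" by simp
    obtain \<delta> where "\<delta> > 0" and \<delta>:
      "\<And>I. nonoverlapping_in t T I \<Longrightarrow> (\<Sum>(a, b)\<in>I. b - a) < \<delta> \<Longrightarrow> (\<Sum>(a, b)\<in>I. norm (y b - y a)) < e / 2"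
      using absolutely_continuous_on_intervalD[OF ac \<open>e / 2 > 0\<close>] by metis
    \<comment> \<open>The errors at tags outside \<open>N\<close> add up to at most
      \<open>e' * (T - t) < e / 2\<close>; the summand \<open>1\<close> keeps the denominator
      positive when \<open>t = T\<close>.\<close>
    define e' where "e' = e / (2 * (T - t + 1))"
    have "e' > 0" using \<open>e > 0\<close> \<open>t \<le> T\<close> by (simp add: e'_def)
    have "N \<in> lmeasurable" using \<open>negligible N\<close> by (rule negligible_imp_measurable)
    obtain G where G: "open G" "N \<subseteq> G" "G - N \<in> lmeasurable" "emeasure lebesgue (G - N) < ennreal \<delta>"
      using sets_lebesgue_outer_open[OF fmeasurableD[OF \<open>N \<in> lmeasurable\<close>] \<open>\<delta> > 0\<close>] by metis
    have "G = N \<union> (G - N)" using G(2) by blast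
    then have lmG: "G \<in> lmeasurable" using fmeasurable.Un[OF \<open>N \<in> lmeasurable\<close> G(3)] by simp
    have "measure lebesgue (G - N) = measure lebesgue G"
      by (rule measure_negligible_symdiff)
        (use \<open>negligible N\<close> G(3) lmG in \<open>auto intro: negligible_subset\<close>)
    then have mG: "measure lebesgue G < \<delta>"
      using G(3,4) \<open>\<delta> > 0\<close> by (simp add: emeasure_eq_measure2 ennreal_less_iff)
    have "\<exists>r>0. \<forall>z\<in>{t..T}. norm (z - x) < r \<longrightarrow> norm (y z - y x - (z - x) *\<^sub>R f x) \<le> e' * norm (z - x)"
      if x: "x \<in> {t..T} - N" for x
    proof -
      have "(y has_derivative (\<lambda>z. z *\<^sub>R f x)) (at x within {t..T})"
        using x vector_derivative_works[of y "at x within {t..T}"]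
        by (auto simp: N_def f_def has_vector_derivative_def)
      then show ?thesis
        using \<open>e' > 0\<close> unfolding has_derivative_within_alt by blast
    qed
    then obtain r where r: "\<And>x. x \<in> {t..T} - N \<Longrightarrow> r x > 0"
      "\<And>x z. x \<in> {t..T} - N \<Longrightarrow> z \<in> {t..T} \<Longrightarrow> norm (z - x) < r x \<Longrightarrow>
        norm (y z - y x - (z - x) *\<^sub>R f x) \<le> e' * norm (z - x)"
      by metis
    \<comment> \<open>Intervals tagged in \<open>N\<close> must lie in \<open>G\<close>, whose
      measure is below \<open>\<delta>\<close>; at the other tags in \<open>{t..T}\<close> the
      radius is the one from differentiability.\<close>
    define \<gamma> where "\<gamma> x = (if x \<in> N then G else if x \<in> {t..T} then ball x (r x) else ball x 1)" for x
    have "gauge \<gamma>"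
      unfolding gauge_def \<gamma>_def using G(1,2) r(1) by auto
    have bound: "norm ((\<Sum>(x, k)\<in>\<D>. measure lborel k *\<^sub>R f x) - (y T - y t)) < e"
      if D: "\<D> tagged_division_of {t..T}" "\<gamma> fine \<D>" for \<D>
    proof -
      note tag = tagged_division_ofD[OF D(1)]
      have finD: "finite \<D>" by (rule tag(1))
      have ivl: "k = {Inf k..Sup k} \<and> x \<in> k \<and> Inf k \<le> x \<and> x \<le> Sup k \<and> t \<le> Inf k \<and> Sup k \<le> T \<and>
          measure lborel k = Sup k - Inf k \<and> k \<subseteq> \<gamma> x" if xk: "(x, k) \<in> \<D>" for x k
      proof -
        obtain a b where k: "k = {a..b}" using tag(4)[OF xk] by auto
        have "x \<in> k" using tag(2)[OF xk] .
        then have "a \<le> b" using k by auto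
        then have "a \<in> k" "b \<in> k" using k by auto
        then have "t \<le> a" "b \<le> T" using tag(3)[OF xk] by auto
        then show ?thesis
          using k \<open>a \<le> b\<close> \<open>x \<in> k\<close> fineD[OF D(2) xk] by auto
      qed
      define err where "err = (\<lambda>(x, k). measure lborel k *\<^sub>R f x - (y (Sup k) - y (Inf k)))"
      \<comment> \<open>Degenerate intervals have zero error. They are left out of \<open>D2\<close>
        so that each remaining interval has an interior point, from which injectivity and
        disjointness of the pairs of end points follow.\<close>
      define D1 D2 where "D1 = {(x, k) \<in> \<D>. x \<notin> N}" and "D2 = {(x, k) \<in> \<D>. x \<in> N \<and> Inf k < Sup k}"
      have "(\<Sum>(x, k)\<in>\<D>. measure lborel k *\<^sub>R f x) - (y T - y t) = sum err \<D>"
        using additive_tagged_division_1[OF \<open>t \<le> T\<close> D(1), of y]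
        by (simp add: err_def split_beta sum_subtractf)
      also have "sum err \<D> = sum err (D1 \<union> D2)"
      proof (rule sum.mono_neutral_right[OF finD])
        show "\<forall>i\<in>\<D> - (D1 \<union> D2). err i = 0"
        proof
          fix i assume i: "i \<in> \<D> - (D1 \<union> D2)"
          obtain x k where [simp]: "i = (x, k)" by (cases i)
          have xk: "(x, k) \<in> \<D>" "\<not> Inf k < Sup k" using i by (auto simp: D1_def D2_def)
          then have "Inf k = Sup k" "measure lborel k = 0" using ivl[OF xk(1)] by auto
          then show "err i = 0" by (simp add: err_def)
        qed
      qed (auto simp: D1_def D2_def)
      also have "\<dots> = sum err D1 + sum err D2"
        using finD by (intro sum.union_disjoint) (auto simp: D1_def D2_def intro: finite_subset)
      finally have split: "(\<Sum>(x, k)\<in>\<D>. measure lborel k *\<^sub>R f x) - (y T - y t) = sum err D1 + sum err D2" .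
      have "norm (err i) \<le> e' * (case i of (x, k) \<Rightarrow> measure lborel k)" if "i \<in> D1" for i
      proof -
        obtain x k where [simp]: "i = (x, k)" by (cases i)
        have xk: "(x, k) \<in> \<D>" "x \<notin> N" using that by (auto simp: D1_def)
        define a b where "a = Inf k" and "b = Sup k"
        have ab: "k = {a..b}" "a \<le> x" "x \<le> b" "t \<le> a" "b \<le> T" "measure lborel k = b - a" "k \<subseteq> ball x (r x)"
          using ivl[OF xk(1)] xk(2) by (auto simp: a_def b_def \<gamma>_def split: if_splits)
        have x: "x \<in> {t..T} - N" using ab xk by auto
        have "a \<in> ball x (r x)" "b \<in> ball x (r x)"
          using ab(1,2,3,7) by (meson atLeastAtMost_iff order_refl order_trans subsetD)+
        then have "norm (a - x) < r x" "norm (b - x) < r x" by (auto simp: dist_real_def)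
        then have "norm (y b - y x - (b - x) *\<^sub>R f x) \<le> e' * (b - x)"
          "norm (y a - y x - (a - x) *\<^sub>R f x) \<le> e' * (x - a)"
          using r(2)[OF x, of a] r(2)[OF x, of b] ab by auto
        \<comment> \<open>The interval is split at its tag, so that the differentiability estimate
          based at \<open>x\<close> applies on each side.\<close>
        moreover have "err i = (b - a) *\<^sub>R f x - (y b - y a)"
          unfolding a_def b_def using ivl[OF xk(1)] by (simp add: err_def)
        then have "err i = (y a - y x - (a - x) *\<^sub>R f x) - (y b - y x - (b - x) *\<^sub>R f x)"
          by (simp add: algebra_simps)
        ultimately have "norm (err i) \<le> e' * (x - a) + e' * (b - x)"
          using norm_triangle_ineq4 order_trans add_mono by metis
        also have "\<dots> = e' * (b - a)" by (simp add: algebra_simps)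
        finally show ?thesis using ab(6) by simp
      qed
      then have "norm (sum err D1) \<le> (\<Sum>i\<in>D1. e' * (case i of (x, k) \<Rightarrow> measure lborel k))"
        by (rule sum_norm_le)
      also have "\<dots> \<le> (\<Sum>i\<in>\<D>. e' * (case i of (x, k) \<Rightarrow> measure lborel k))"
        using finD \<open>e' > 0\<close> by (intro sum_mono2) (auto simp: D1_def)
      also have "\<dots> = e' * (T - t)"
        using additive_content_tagged_division[of \<D> t T] D(1) \<open>t \<le> T\<close>
        by (simp add: sum_distrib_left[symmetric])
      also have "\<dots> < e / 2"
        using \<open>e > 0\<close> \<open>t \<le> T\<close> by (simp add: e'_def field_simps)
      finally have norm1: "norm (sum err D1) < e / 2" .
      define I where "I = (\<lambda>(x, k). (Inf k, Sup k)) ` D2"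
      have finD2: "finite D2" using finD by (auto simp: D2_def intro: finite_subset)
      have disj: "i = j" if i: "i \<in> D2" and j: "j \<in> D2"
        and z: "Inf (snd i) < z" "z < Sup (snd i)" "Inf (snd j) < z" "z < Sup (snd j)" for i j z
      proof (rule ccontr)
        assume "i \<noteq> j"
        have ij: "(fst i, snd i) \<in> \<D>" "(fst j, snd j) \<in> \<D>" using i j by (auto simp: D2_def)
        then have "interior (snd i) \<inter> interior (snd j) = {}"
          using tag(5)[OF ij] \<open>i \<noteq> j\<close> by (metis prod.collapse)
        moreover have "z \<in> interior (snd i)"
          using ivl[OF ij(1)] z interior_atLeastAtMost_real by (metis greaterThanLessThan_iff)
        moreover have "z \<in> interior (snd j)"
          using ivl[OF ij(2)] z interior_atLeastAtMost_real by (metis greaterThanLessThan_iff)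
        ultimately show False by blast
      qed
      have inj: "inj_on (\<lambda>(x, k). (Inf k, Sup k)) D2"
      proof (rule inj_onI)
        fix i j assume ij: "i \<in> D2" "j \<in> D2" "(case i of (x, k) \<Rightarrow> (Inf k, Sup k)) = (case j of (x, k) \<Rightarrow> (Inf k, Sup k))"
        then have "Inf (snd i) < Sup (snd i)" by (auto simp: D2_def)
        then obtain z where "Inf (snd i) < z" "z < Sup (snd i)" using dense by blast
        then show "i = j" using ij by (intro disj[of i j z]) (auto simp: split_beta)
      qed
      have mem: "t \<le> a \<and> a \<le> b \<and> b \<le> T \<and> {a<..<b} \<subseteq> G" if ab: "(a, b) \<in> I" for a b
      proof -
        obtain x k where xk: "(x, k) \<in> D2" "a = Inf k" "b = Sup k" using ab by (auto simp: I_def)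
        have "k = {a..b}" "x \<in> N" "k \<subseteq> G" "t \<le> a" "a \<le> b" "b \<le> T"
          using ivl[of x k] xk by (auto simp: D2_def \<gamma>_def)
        moreover have "{a<..<b} \<subseteq> {a..b}" by auto
        ultimately show ?thesis by blast
      qed
      have disjI: "disjoint_family_on (\<lambda>(a, b). {a<..<b}) I"
        unfolding disjoint_family_on_def
      proof (intro ballI impI equals0I)
        fix p q z assume pq: "p \<in> I" "q \<in> I" "p \<noteq> q"
          "z \<in> (case p of (a, b) \<Rightarrow> {a<..<b}) \<inter> (case q of (a, b) \<Rightarrow> {a<..<b})"
        then obtain i j where ij: "i \<in> D2" "p = (Inf (snd i), Sup (snd i))" "j \<in> D2" "q = (Inf (snd j), Sup (snd j))"
          by (auto simp: I_def split_beta)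
        then have "i = j" using pq by (intro disj[of i j z]) auto
        then show False using pq ij by simp
      qed
      have finI: "finite I" using finD2 by (simp add: I_def)
      have "(\<Sum>(a, b)\<in>I. b - a) = measure lebesgue (\<Union>(a, b)\<in>I. {a<..<b})"
        using mem by (intro sum_interval_lengths[OF finI disjI, symmetric]) blast
      also have "\<dots> \<le> measure lebesgue G"
      proof (rule measure_mono_fmeasurable)
        show "(\<Union>(a, b)\<in>I. {a<..<b}) \<subseteq> G" using mem by blast
      qed (use finI lmG in \<open>auto intro!: fmeasurableD lmeasurable_Union_intervals\<close>)
      finally have "(\<Sum>(a, b)\<in>I. b - a) < \<delta>" using mG by simp
      moreover have "nonoverlapping_in t T I"
        unfolding nonoverlapping_in_def using finI disjI mem by blast
      ultimately have "(\<Sum>(a, b)\<in>I. norm (y b - y a)) < e / 2" by (rule \<delta>[rotated])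
      also have "(\<Sum>(a, b)\<in>I. norm (y b - y a)) = (\<Sum>i\<in>D2. norm (err i))"
        unfolding I_def
      proof (subst sum.reindex[OF inj], rule sum.cong)
        fix i assume "i \<in> D2"
        then show "((\<lambda>(a, b). norm (y b - y a)) \<circ> (\<lambda>(x, k). (Inf k, Sup k))) i = norm (err i)"
          by (cases i) (simp add: D2_def err_def f_def, rule norm_minus_commute)
      qed simp
      finally have norm2: "norm (sum err D2) < e / 2"
        using norm_sum[of err D2] by linarith
      show ?thesis
        unfolding split using norm1 norm2 norm_triangle_ineq[of "sum err D1" "sum err D2"] by linarith
    qed
    show "\<exists>\<gamma>. gauge \<gamma> \<and> (\<forall>\<D>. \<D> tagged_division_of {t..T} \<and> \<gamma> fine \<D> \<longrightarrow>
        norm ((\<Sum>(x, k)\<in>\<D>. measure lborel k *\<^sub>R f x) - (y T - y t)) < e)"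
      by (intro exI[of _ \<gamma>] conjI allI impI \<open>gauge \<gamma>\<close>) (elim conjE, rule bound)
  qed
  then show ?thesis
    by (rule has_integral_spike[OF \<open>negligible N\<close>, rotated]) (simp add: f_def)
qed

section \<open>Superlinear convex functions\<close>

lemma gradient_eqI:
  assumes "(f has_derivative (\<lambda>h. h \<bullet> D)) (at x)"
  shows "gradient f x = D"
  unfolding gradient_def
proof (rule the_equality)
  show "GDERIV f x :> D" using assms by (simp add: gderiv_def)
  fix D' assume "GDERIV f x :> D'"
  then have "(f has_derivative (\<lambda>h. h \<bullet> D')) (at x)" by (simp add: gderiv_def)
  from has_derivative_unique[OF this assms] show "D' = D"
    by (metis inner_commute vector_eq_ldot)
qed

text \<open>The derivative is represented by the vector of its values on the basis; uniqueness
  identifies that vector with the definite description in \<open>gradient\<close>.\<close>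

lemma has_derivative_gradient:
  fixes f :: "'a::euclidean_space \<Rightarrow> real"
  assumes "f differentiable (at x)"
  shows "(f has_derivative (\<lambda>h. h \<bullet> gradient f x)) (at x)"
proof -
  obtain f' where f': "(f has_derivative f') (at x)" using assms by (auto simp: differentiable_def)
  define D where "D = (\<Sum>b\<in>Basis. f' b *\<^sub>R b)"
  have lin: "linear f'" using f' by (rule has_derivative_linear)
  have "f' h = h \<bullet> D" for h
  proof -
    have "f' h = f' (\<Sum>b\<in>Basis. (h \<bullet> b) *\<^sub>R b)" by (simp add: euclidean_representation)
    also have "\<dots> = (\<Sum>b\<in>Basis. (h \<bullet> b) * f' b)"
      by (simp add: linear_sum[OF lin] linear_scale[OF lin])
    also have "\<dots> = h \<bullet> D" by (simp add: D_def inner_sum_right mult.commute)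
    finally show ?thesis .
  qed
  then have "f' = (\<lambda>h. h \<bullet> D)" by auto
  then show ?thesis using f' gradient_eqI by metis
qed

text \<open>Minimization over a closed ball containing the sublevel set of \<open>f 0\<close>. This
  form serves \<open>extremal_cost\<close>, for which bounded sublevel sets in \<open>p\<close> are
  shown; the surjectivity proofs use the linear growth version below.\<close>

lemma bounded_sublevel_attains_inf:
  fixes f :: "'a::euclidean_space \<Rightarrow> real"
  assumes "continuous_on UNIV f" and "bounded {u. f u \<le> f 0}"
  obtains m where "\<And>u. f m \<le> f u"
proof -
  obtain R where R: "\<And>u. f u \<le> f 0 \<Longrightarrow> norm u \<le> R"
    using assms(2) by (auto simp: bounded_iff)
  then have "norm (0 :: 'a) \<le> R" by blast
  have "continuous_on (cball 0 R) f" using assms(1) by (rule continuous_on_subset) auto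
  then obtain m where m: "m \<in> cball 0 R" "\<And>u. u \<in> cball 0 R \<Longrightarrow> f m \<le> f u"
    using continuous_attains_inf[of "cball 0 R" f] \<open>norm (0 :: 'a) \<le> R\<close> by auto
  have "f m \<le> f u" for u
  proof (cases "f u \<le> f 0")
    case False
    then show ?thesis using m(2)[of 0] \<open>norm (0 :: 'a) \<le> R\<close> by simp
  qed (use R m in auto)
  then show ?thesis by (rule that)
qed

lemma coercive_attains_inf:
  fixes f :: "'a::euclidean_space \<Rightarrow> real"
  assumes "continuous_on UNIV f" and coercive: "\<And>u. norm u - C \<le> f u"
  obtains m where "\<And>u. f m \<le> f u"
proof (rule bounded_sublevel_attains_inf[OF assms(1)])
  have "norm u \<le> C + f 0" if "f u \<le> f 0" for u
    using coercive[of u] that by simp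
  then show "bounded {u. f u \<le> f 0}" by (auto simp: bounded_iff)
qed (rule that; assumption)

lemma superlinear_lower_bound:
  fixes f :: "'a::euclidean_space \<Rightarrow> real"
  assumes cont: "continuous_on UNIV f" and super: "filterlim (\<lambda>u. f u / norm u) at_top at_infinity"
  obtains C where "\<And>u. K * norm u - C \<le> f u"
proof -
  have "eventually (\<lambda>u. K \<le> f u / norm u) at_infinity"
    using super by (simp add: filterlim_at_top)
  then obtain R where R: "\<And>u. norm u \<ge> R \<Longrightarrow> K \<le> f u / norm u"
    by (auto simp: eventually_at_infinity)
  \<comment> \<open>Radius at least \<open>1\<close>, so that outside the ball \<open>norm u\<close>
    is positive and the quotient can be cleared.\<close>
  define R' where "R' = max R 1"
  have "compact ((\<lambda>u. K * norm u - f u) ` cball 0 R')"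
    using cont by (intro compact_continuous_image continuous_intros) (auto intro: continuous_on_subset)
  then have "bounded ((\<lambda>u. K * norm u - f u) ` cball 0 R')" by (rule compact_imp_bounded)
  then obtain B where "\<forall>z\<in>(\<lambda>u. K * norm u - f u) ` cball 0 R'. norm z \<le> B"
    unfolding bounded_iff by blast
  then have B: "\<bar>K * norm u - f u\<bar> \<le> B" if "u \<in> cball 0 R'" for u
    using that by auto
  have "K * norm u - \<bar>B\<bar> \<le> f u" for u
  proof (cases "norm u \<le> R'")
    case True
    then show ?thesis using B[of u] by simp
  next
    case False
    then have "K \<le> f u / norm u" "norm u > 0" using R[of u] by (auto simp: R'_def)
    then show ?thesis by (simp add: pos_le_divide_eq)
  qed
  then show ?thesis by (rule that)
qed

section \<open>The gradient bijection and the conjugate function\<close>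

locale superlinear_cost =
  fixes l :: "real^'n \<Rightarrow> real"
  assumes differentiable: "\<And>u. l differentiable (at u)"
    and continuous_gradient: "continuous_on UNIV (gradient l)"
    and strictly_convex: "strictly_convex l"
    and superlinear: "filterlim (\<lambda>u. l u / norm u) at_top at_infinity"
begin

lemma deriv: "(l has_derivative (\<lambda>h. h \<bullet> gradient l u)) (at u)"
  by (rule has_derivative_gradient[OF differentiable])

lemma continuous: "continuous_on UNIV l"
  by (rule differentiable_imp_continuous_on) (simp add: differentiable differentiable_on_def)

text \<open>Convexity bounds the difference quotients of \<open>l\<close> along the segment from
  \<open>v\<close> to \<open>u\<close> by \<open>l u - l v\<close>; their limit from the right at
  \<open>0\<close> is the directional derivative.\<close>

lemma tangent_le: "l v + gradient l v \<bullet> (u - v) \<le> l u"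
proof (cases "u = v")
  case False
  define \<phi> where "\<phi> s = l (v + s *\<^sub>R (u - v))" for s :: real
  have "(\<phi> has_derivative (\<lambda>s. (s *\<^sub>R (u - v)) \<bullet> gradient l v)) (at 0)"
    unfolding \<phi>_def
    by (rule has_derivative_compose[of "\<lambda>s. v + s *\<^sub>R (u - v)" _ 0 UNIV l])
      (auto intro!: derivative_eq_intros deriv)
  moreover have "(\<lambda>s. (s *\<^sub>R (u - v)) \<bullet> gradient l v) = (*) (gradient l v \<bullet> (u - v))"
    by (rule ext) (simp only: inner_scaleR_left inner_commute[of "u - v"] mult.commute)
  ultimately have "(\<phi> has_field_derivative (gradient l v \<bullet> (u - v))) (at 0)"
    by (simp only: has_field_derivative_def)
  then have "(\<lambda>s. (\<phi> (0 + s) - \<phi> 0) / s) \<midarrow>0\<rightarrow> gradient l v \<bullet> (u - v)"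
    by (rule DERIV_D)
  then have "((\<lambda>s. (\<phi> s - \<phi> 0) / s) \<longlongrightarrow> gradient l v \<bullet> (u - v)) (at_right 0)"
    by (simp add: filterlim_at_split)
  moreover have "eventually (\<lambda>s. (\<phi> s - \<phi> 0) / s \<le> l u - l v) (at_right 0)"
  proof -
    have "eventually (\<lambda>s. s \<in> {0<..<1}) (at_right (0::real))" by (rule eventually_at_right_real) simp
    then show ?thesis
    proof eventually_elim
      case (elim s)
      have "\<phi> s = l ((1 - s) *\<^sub>R v + s *\<^sub>R u)" by (simp add: \<phi>_def algebra_simps)
      also have "\<dots> < (1 - s) * l v + s * l u"
        by (rule strictly_convex[unfolded strictly_convex_def, rule_format]) (use elim False in auto)
      finally show ?case using elim by (simp add: \<phi>_def field_simps)
    qed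
  qed
  ultimately have "gradient l v \<bullet> (u - v) \<le> l u - l v"
    by (intro tendsto_upperbound) auto
  then show ?thesis by simp
qed simp

lemma lower_bound:
  obtains C where "\<And>u. K * norm u - C \<le> l u"
  using superlinear_lower_bound[OF continuous superlinear] by blast

text \<open>If the gradients agree, the tangent inequalities based at \<open>u\<close> and at
  \<open>v\<close>, both evaluated at the midpoint \<open>m\<close>, add up to
  \<open>l u + l v \<le> 2 * l m\<close>, against strict convexity.\<close>

lemma inj_gradient: "inj (gradient l)"
proof (rule injI, rule ccontr)
  fix u v assume eq: "gradient l u = gradient l v" and "u \<noteq> v"
  define m where "m = (1 - 1/2) *\<^sub>R u + (1/2 :: real) *\<^sub>R v"
  have "l m < (1 - 1/2) * l u + 1/2 * l v"
    unfolding m_def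
    by (rule strictly_convex[unfolded strictly_convex_def, rule_format]) (use \<open>u \<noteq> v\<close> in auto)
  moreover have "gradient l v \<bullet> (m - v) = - (gradient l v \<bullet> (m - u))"
  proof -
    have "m - v = - (m - u)" by (simp add: m_def vec_eq_iff field_simps)
    then show ?thesis by (simp only: inner_minus_right)
  qed
  ultimately show False
    using tangent_le[of u m, unfolded eq] tangent_le[of v m] by (simp add: field_simps)
qed

text \<open>A minimizer of \<open>l u - u \<bullet> p\<close> has gradient \<open>p\<close>. The
  slope \<open>norm p + 1\<close> in \<open>lower_bound\<close> dominates the linear term and leaves
  \<open>norm u\<close> as growth.\<close>

lemma surj_gradient: "surj (gradient l)"
proof (unfold surj_def, intro allI)
  fix p :: "real^'n"
  obtain C where C: "\<And>u. (norm p + 1) * norm u - C \<le> l u" using lower_bound by metis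
  have coercive: "norm u - C \<le> l u - u \<bullet> p" for u
    using C[of u] Cauchy_Schwarz_ineq2[of u p] by (simp add: algebra_simps)
  have "continuous_on UNIV (\<lambda>u. l u - u \<bullet> p)"
    by (intro continuous_intros continuous)
  from coercive_attains_inf[OF this coercive]
  obtain m where m: "\<And>u. l m - m \<bullet> p \<le> l u - u \<bullet> p" by blast
  have "((\<lambda>u. l u - u \<bullet> p) has_derivative (\<lambda>h. h \<bullet> gradient l m - h \<bullet> p)) (at m)"
    by (auto intro!: derivative_eq_intros deriv)
  then have "(\<lambda>h. h \<bullet> gradient l m - h \<bullet> p) = (\<lambda>h. 0)"
    using m by (intro differential_zero_maxmin[of m UNIV "\<lambda>u. l u - u \<bullet> p"]) auto
  then have "gradient l m = p"
    by (metis eq_iff_diff_eq_0 inner_commute vector_eq_ldot)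
  then show "\<exists>x. p = gradient l x" by blast
qed

lemma gradient_iota [simp]: "gradient l (iota l p) = p"
  unfolding iota_def by (rule surj_f_inv_f[OF surj_gradient])

lemma iota_gradient [simp]: "iota l (gradient l u) = u"
  unfolding iota_def by (rule inv_f_f[OF inj_gradient])

text \<open>The inverse of an injective continuous map between spaces of equal dimension is
  continuous by invariance of domain.\<close>

lemma continuous_iota: "continuous_on UNIV (iota l)"
proof -
  have "continuous_on (gradient l ` UNIV) (iota l)"
    by (rule continuous_on_inverse_open[OF open_UNIV continuous_gradient]) auto
  then show ?thesis using surj_gradient by simp
qed

text \<open>The tangent inequality at the point with gradient \<open>p\<close>; hence the supremum
  in \<open>conjugate\<close> is attained there.\<close>

lemma Fenchel_le: "p \<bullet> u - l u \<le> p \<bullet> iota l p - l (iota l p)"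
  using tangent_le[of "iota l p" u] by (simp add: algebra_simps)

lemma conjugate_eq: "conjugate l p = p \<bullet> iota l p - l (iota l p)"
  unfolding conjugate_def
  by (rule cSup_eq_maximum) (auto simp: Fenchel_le)

end

section \<open>Minimizers for a fixed discount\<close>

lemma extended_integral_integrable:
  assumes "integrable M f"
  shows "extended_integral M f = ereal (integral\<^sup>L M f)"
proof -
  have fin: "(\<integral>\<^sup>+ x. ennreal (f x) \<partial>M) \<noteq> \<infinity>" "(\<integral>\<^sup>+ x. ennreal (- f x) \<partial>M) \<noteq> \<infinity>"
    using assms by (auto simp: real_integrable_def)
  obtain p where p: "(\<integral>\<^sup>+ x. ennreal (f x) \<partial>M) = ennreal p" "p \<ge> 0"
    using fin(1) by (cases "\<integral>\<^sup>+ x. ennreal (f x) \<partial>M") auto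
  obtain q where q: "(\<integral>\<^sup>+ x. ennreal (- f x) \<partial>M) = ennreal q" "q \<ge> 0"
    using fin(2) by (cases "\<integral>\<^sup>+ x. ennreal (- f x) \<partial>M") auto
  show ?thesis
    unfolding extended_integral_def real_lebesgue_integral_def[OF assms] p(1) q(1)
    using p(2) q(2) by simp
qed

lemma Lipschitz_imp_absolutely_continuous:
  assumes "\<And>a b. t \<le> a \<Longrightarrow> a \<le> b \<Longrightarrow> b \<le> T \<Longrightarrow> norm (y b - y a) \<le> M * (b - a)"
  shows "absolutely_continuous_on_interval t T y"
  unfolding absolutely_continuous_on_interval_def
proof (intro allI impI)
  fix \<epsilon> :: real assume "\<epsilon> > 0"
  show "\<exists>\<delta>>0. \<forall>I. finite I \<and> (\<forall>(a, b)\<in>I. t \<le> a \<and> a \<le> b \<and> b \<le> T) \<and>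
        disjoint_family_on (\<lambda>(a, b). {a<..<b}) I \<and> (\<Sum>(a, b)\<in>I. b - a) < \<delta> \<longrightarrow>
        (\<Sum>(a, b)\<in>I. norm (y b - y a)) < \<epsilon>"
  proof (intro exI[of _ "\<epsilon> / (\<bar>M\<bar> + 1)"] conjI allI impI)
    fix I :: "(real \<times> real) set"
    assume I: "finite I \<and> (\<forall>(a, b)\<in>I. t \<le> a \<and> a \<le> b \<and> b \<le> T) \<and>
        disjoint_family_on (\<lambda>(a, b). {a<..<b}) I \<and> (\<Sum>(a, b)\<in>I. b - a) < \<epsilon> / (\<bar>M\<bar> + 1)"
    have "(case i of (a, b) \<Rightarrow> norm (y b - y a)) \<le> (\<bar>M\<bar> + 1) * (case i of (a, b) \<Rightarrow> b - a)" if "i \<in> I" for i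
    proof -
      obtain a b where [simp]: "i = (a, b)" by (cases i)
      have ab: "t \<le> a" "a \<le> b" "b \<le> T" using I that by auto
      have "norm (y b - y a) \<le> M * (b - a)" using assms ab by blast
      also have "\<dots> \<le> (\<bar>M\<bar> + 1) * (b - a)" using ab by (intro mult_right_mono) auto
      finally show ?thesis by simp
    qed
    then have "(\<Sum>(a, b)\<in>I. norm (y b - y a)) \<le> (\<bar>M\<bar> + 1) * (\<Sum>(a, b)\<in>I. b - a)"
      unfolding sum_distrib_left by (rule sum_mono)
    also have "\<dots> < (\<bar>M\<bar> + 1) * (\<epsilon> / (\<bar>M\<bar> + 1))"
      using I by (intro mult_strict_left_mono) auto
    finally show "(\<Sum>(a, b)\<in>I. norm (y b - y a)) < \<epsilon>" by simp
  qed (use \<open>\<epsilon> > 0\<close> in simp)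
qed

text \<open>The initial time is a parameter of the locale: the final argument interprets it at
  \<open>t\<close> and at each neighbouring \<open>\<tau>\<close>, every time with its own
  discount.\<close>

locale discounted_problem = superlinear_cost l
  for l :: "real^'n \<Rightarrow> real" +
  fixes g :: "real^'n \<Rightarrow> real" and d :: "real \<Rightarrow> real \<Rightarrow> real" and a t T L :: real
  assumes Lipschitz: "L-lipschitz_on UNIV g"
    and a_pos: "a > 0"
    and t_less_T: "t < T"
    and discount_bounds: "\<And>s. s \<in> {t..T} \<Longrightarrow> a < d t s \<and> d t s \<le> 1"
    and continuous_discount: "continuous_on {t..T} (d t)"
begin

text \<open>Extremals are parametrized by their conserved momentum \<open>p\<close>: the integrand
  does not depend on the state, so the Euler-Lagrange equation makes the momentum constant in
  \<open>s\<close>.\<close>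

definition ctrl :: "real^'n \<Rightarrow> real \<Rightarrow> real^'n" where
  "ctrl p s = iota l ((1 / d t s) *\<^sub>R p)"

definition displacement :: "real^'n \<Rightarrow> real^'n" where
  "displacement p = integral {t..T} (ctrl p)"

definition running :: "(real \<Rightarrow> real^'n) \<Rightarrow> real" where
  "running u = integral {t..T} (\<lambda>s. d t s * l (u s))"

definition extremal_cost :: "real^'n \<Rightarrow> real^'n \<Rightarrow> real" where
  "extremal_cost x p = running (ctrl p) + d t T * g (x + displacement p)"

lemma discount_pos: "s \<in> {t..T} \<Longrightarrow> d t s > 0"
  using discount_bounds[of s] a_pos by auto

text \<open>Joint continuity in \<open>p\<close> and \<open>s\<close> is what carries continuity in
  \<open>p\<close> through the integrals in \<open>displacement\<close> and
  \<open>running\<close>.\<close>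

lemma continuous_ctrl2: "continuous_on (UNIV \<times> {t..T}) (\<lambda>(p, s). ctrl p s)"
proof -
  have "continuous_on ((UNIV :: (real^'n) set) \<times> {t..T}) (\<lambda>q. d t (snd q))"
    by (rule continuous_on_compose2[OF continuous_discount continuous_on_snd[OF continuous_on_id]]) auto
  then have "continuous_on ((UNIV :: (real^'n) set) \<times> {t..T}) (\<lambda>q. (1 / d t (snd q)) *\<^sub>R fst q)"
    by (intro continuous_on_scaleR continuous_on_divide continuous_on_const continuous_on_fst continuous_on_id)
      (auto dest: discount_pos)
  then show ?thesis
    unfolding ctrl_def split_beta by (intro continuous_on_compose2[OF continuous_iota]) auto
qed

lemma continuous_ctrl: "continuous_on {t..T} (ctrl p)"
proof -
  have "continuous_on {t..T} (\<lambda>s. (p, s))" by (intro continuous_intros)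
  from continuous_on_compose2[OF continuous_ctrl2 this] show ?thesis by auto
qed

lemma continuous_running_integrand:
  "continuous_on {t..T} u \<Longrightarrow> continuous_on {t..T} (\<lambda>s. d t s * l (u s))"
  by (intro continuous_intros continuous_discount continuous_on_compose2[OF continuous]) auto

lemma continuous_displacement: "continuous_on UNIV displacement"
  using integral_continuous_on_param[of UNIV t T ctrl] continuous_ctrl2
  by (simp add: displacement_def[abs_def])

lemma continuous_running_ctrl: "continuous_on UNIV (\<lambda>p. running (ctrl p))"
proof -
  have "continuous_on ((UNIV :: (real^'n) set) \<times> {t..T}) (\<lambda>q. d t (snd q))"
    by (rule continuous_on_compose2[OF continuous_discount continuous_on_snd[OF continuous_on_id]]) auto
  moreover have "continuous_on (UNIV \<times> {t..T}) (\<lambda>q. l (ctrl (fst q) (snd q)))"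
    using continuous_ctrl2 unfolding split_beta by (intro continuous_on_compose2[OF continuous]) auto
  ultimately have "continuous_on (UNIV \<times> {t..T}) (\<lambda>(p, s). d t s * l (ctrl p s))"
    unfolding split_beta by (rule continuous_on_mult)
  then show ?thesis
    using integral_continuous_on_param[of UNIV t T "\<lambda>p s. d t s * l (ctrl p s)"]
    by (simp add: running_def)
qed

lemma continuous_g: "continuous_on UNIV g"
  using Lipschitz by (rule lipschitz_on_continuous_on)

text \<open>\<open>Fenchel_le\<close> at \<open>(1 / d t s) *\<^sub>R p\<close>, multiplied by the
  positive discount. Integrating it yields both the convexity used in
  \<open>surj_displacement\<close> and the comparison with arbitrary curves.\<close>

lemma ctrl_maximizes:
  assumes "s \<in> {t..T}"
  shows "p \<bullet> u - d t s * l u \<le> p \<bullet> ctrl p s - d t s * l (ctrl p s)"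
proof -
  have "d t s * (((1 / d t s) *\<^sub>R p) \<bullet> u - l u) \<le> d t s * (((1 / d t s) *\<^sub>R p) \<bullet> ctrl p s - l (ctrl p s))"
    unfolding ctrl_def using discount_pos[OF assms] by (intro mult_left_mono Fenchel_le) auto
  then show ?thesis using discount_pos[OF assms] by (simp add: right_diff_distrib)
qed

lemma gradient_ctrl: "s \<in> {t..T} \<Longrightarrow> d t s *\<^sub>R gradient l (ctrl p s) = p"
  using discount_pos[of s] by (simp add: ctrl_def)

lemma integral_inner_ctrl: "integral {t..T} (\<lambda>s. q \<bullet> ctrl p s) = q \<bullet> displacement p"
  using integral_linear[OF integrable_continuous_real[OF continuous_ctrl] bounded_linear_inner_right, of q p]
  by (simp add: displacement_def o_def)

text \<open>\<open>displacement\<close> is the gradient of the convex function \<open>h\<close>, so a minimizer of \<open>h p - p \<bullet> q\<close> is mapped to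
  \<open>q\<close>; differentiability of \<open>h\<close> is replaced by the subgradient inequality and continuity of
  \<open>displacement\<close>.\<close>

lemma surj_displacement: "\<exists>p. displacement p = q"
proof -
  \<comment> \<open>\<open>h p\<close> is the integral over \<open>s\<close> of the conjugate of
    \<open>\<lambda>u. d t s * l u\<close> at \<open>p\<close>.\<close>
  define h where "h p = p \<bullet> displacement p - running (ctrl p)" for p
  have h_eq: "h p = integral {t..T} (\<lambda>s. p \<bullet> ctrl p s - d t s * l (ctrl p s))" for p
    unfolding h_def running_def integral_inner_ctrl[symmetric]
    by (intro integral_diff[symmetric] integrable_continuous_real continuous_running_integrand continuous_ctrl
        continuous_on_inner continuous_on_const)
  have subgradient: "h p + (p' - p) \<bullet> displacement p \<le> h p'" for p p'
  proof -
    have "h p + (p' - p) \<bullet> displacement p =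
      integral {t..T} (\<lambda>s. (p \<bullet> ctrl p s - d t s * l (ctrl p s)) + (p' - p) \<bullet> ctrl p s)"
      unfolding h_eq integral_inner_ctrl[symmetric]
      by (intro integral_add[symmetric] integrable_continuous_real continuous_running_integrand continuous_ctrl
        continuous_on_inner continuous_on_const continuous_on_diff)
    also have "\<dots> \<le> h p'"
      unfolding h_eq
    proof (rule integral_le)
      fix s assume "s \<in> {t..T}"
      from ctrl_maximizes[OF this, of p' "ctrl p s"]
      show "p \<bullet> ctrl p s - d t s * l (ctrl p s) + (p' - p) \<bullet> ctrl p s \<le> p' \<bullet> ctrl p' s - d t s * l (ctrl p' s)"
        by (simp add: inner_diff_left)
    qed (intro integrable_continuous_real continuous_running_integrand continuous_ctrl
        continuous_on_inner continuous_on_const continuous_on_diff continuous_on_add)+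
    finally show ?thesis .
  qed
  \<comment> \<open>With this \<open>c\<close>, \<open>(T - t) * c * norm p\<close> exceeds
    \<open>p \<bullet> q\<close> by at least \<open>norm p\<close>, which makes
    \<open>h p - p \<bullet> q\<close> coercive.\<close>
  define c where "c = (norm q + 1) / (T - t)"
  have "c > 0" using t_less_T by (auto simp: c_def intro!: divide_pos_pos add_nonneg_pos)
  have "compact (l ` cball 0 c)"
    using continuous by (intro compact_continuous_image) (auto intro: continuous_on_subset)
  then have "bounded (l ` cball 0 c)" by (rule compact_imp_bounded)
  then obtain M where "\<forall>z\<in>l ` cball 0 c. norm z \<le> M" unfolding bounded_iff by blast
  then have M: "\<bar>l u\<bar> \<le> M" if "norm u \<le> c" for u using that by auto
  have coercive: "norm p - (T - t) * M \<le> h p - p \<bullet> q" for p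
  proof -
    \<comment> \<open>A test vector in the direction of \<open>p\<close>. For \<open>p = 0\<close>
      division by zero makes it \<open>0\<close>, and both properties below still hold.\<close>
    define u where "u = (c / norm p) *\<^sub>R p"
    have u: "norm u \<le> c" "p \<bullet> u = c * norm p"
      using \<open>c > 0\<close> by (auto simp: u_def dot_square_norm power2_eq_square)
    have "(T - t) * (c * norm p - M) = integral {t..T} (\<lambda>s. c * norm p - M)"
      using t_less_T by simp
    also have "\<dots> \<le> h p"
      unfolding h_eq
    proof (rule integral_le)
      fix s assume s: "s \<in> {t..T}"
      have "d t s * l u \<le> d t s * \<bar>l u\<bar>" using discount_pos[OF s] by (intro mult_left_mono) auto
      also have "\<dots> \<le> 1 * \<bar>l u\<bar>" using discount_bounds[OF s] by (intro mult_right_mono) auto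
      also have "\<dots> \<le> M" using M[OF u(1)] by simp
      finally show "c * norm p - M \<le> p \<bullet> ctrl p s - d t s * l (ctrl p s)"
        using ctrl_maximizes[OF s, of p u] u(2) by linarith
    qed (intro integrable_continuous_real continuous_running_integrand continuous_ctrl
        continuous_on_inner continuous_on_const continuous_on_diff)+
    finally have "(norm q + 1) * norm p - (T - t) * M \<le> h p"
      using t_less_T by (simp add: c_def right_diff_distrib)
    moreover have "p \<bullet> q \<le> norm p * norm q" by (rule norm_cauchy_schwarz)
    ultimately show ?thesis by (simp add: algebra_simps)
  qed
  have "continuous_on UNIV (\<lambda>p. h p - p \<bullet> q)"
    unfolding h_def by (intro continuous_intros continuous_displacement continuous_running_ctrl)
  from coercive_attains_inf[OF this coercive]
  obtain p where p: "\<And>p'. h p - p \<bullet> q \<le> h p' - p' \<bullet> q" by blast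
  define v where "v = displacement p - q"
  \<comment> \<open>Minimality at \<open>p\<close> is played against the subgradient inequality
    based at \<open>p - e *\<^sub>R v\<close>; as \<open>e\<close> tends to \<open>0\<close>,
    continuity of \<open>displacement\<close> turns the result into
    \<open>v \<bullet> v \<le> 0\<close>.\<close>
  have "v \<bullet> (displacement (p - e *\<^sub>R v) - q) \<le> 0" if "e > 0" for e
  proof -
    have "h (p - e *\<^sub>R v) + (e *\<^sub>R v) \<bullet> displacement (p - e *\<^sub>R v) \<le> h p"
      using subgradient[of "p - e *\<^sub>R v" p] by simp
    also have "h p \<le> h (p - e *\<^sub>R v) + e * (v \<bullet> q)"
      using p[of "p - e *\<^sub>R v"] by (simp add: inner_diff_left)
    finally have "e * (v \<bullet> (displacement (p - e *\<^sub>R v) - q)) \<le> 0"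
      by (simp add: inner_diff_right right_diff_distrib)
    then show ?thesis using that by (simp add: mult_le_0_iff)
  qed
  moreover have "((\<lambda>e. v \<bullet> (displacement (p - e *\<^sub>R v) - q)) \<longlongrightarrow> v \<bullet> v) (at_right 0)"
  proof -
    have "continuous_on UNIV (\<lambda>e. v \<bullet> (displacement (p - e *\<^sub>R v) - q))"
      by (intro continuous_intros continuous_on_compose2[OF continuous_displacement]) auto
    then have "isCont (\<lambda>e. v \<bullet> (displacement (p - e *\<^sub>R v) - q)) 0"
      by (simp add: continuous_on_eq_continuous_at)
    then show ?thesis by (simp add: isCont_def filterlim_at_split v_def)
  qed
  ultimately have "v \<bullet> v \<le> 0"
    by (intro tendsto_upperbound[of _ "v \<bullet> v" "at_right 0"]) (auto simp: eventually_at_right_less intro!: eventually_at_right_less[THEN eventually_mono])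
  then have "v = 0" using inner_ge_zero[of v] by (metis antisym inner_eq_zero_iff)
  then show ?thesis by (auto simp: v_def)
qed


section \<open>Comparison with admissible curves and existence of a minimizer\<close>

lemma cost_of_control:
  fixes x :: "real^'n"
  assumes u: "continuous_on {t..T} u"
  defines "y \<equiv> \<lambda>s. x + integral {t..s} u"
  shows "y \<in> AC T x t"
    and "cost T l g d t y = ereal (running u + d t T * g (x + integral {t..T} u))"
proof -
  \<comment> \<open>A continuous control is bounded on the interval, so its trajectory is Lipschitz
    and hence absolutely continuous.\<close>
  have "compact (u ` {t..T})" using u by (intro compact_continuous_image) auto
  then have "bounded (u ` {t..T})" by (rule compact_imp_bounded)
  then obtain M where "\<forall>z\<in>u ` {t..T}. norm z \<le> M" unfolding bounded_iff by blast
  then have M: "norm (u s) \<le> M" if "s \<in> {t..T}" for s using that by auto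
  have int: "u integrable_on {b..c}" if "t \<le> b" "c \<le> T" for b c
    using u that by (intro integrable_continuous_real) (auto intro: continuous_on_subset)
  have "absolutely_continuous_on_interval t T y"
  proof (rule Lipschitz_imp_absolutely_continuous)
    fix b c assume bc: "t \<le> b" "b \<le> c" "c \<le> T"
    have "y c - y b = integral {b..c} u"
      using Henstock_Kurzweil_Integration.integral_combine[OF bc(1,2) int] bc by (simp add: y_def algebra_simps)
    also have "norm \<dots> \<le> M * (c - b)"
      using bc M u by (intro integral_bound) (auto intro: continuous_on_subset)
    finally show "norm (y c - y b) \<le> M * (c - b)" .
  qed
  then show "y \<in> AC T x t" by (simp add: AC_def y_def)
  have vd: "vector_derivative y (at s within {t..T}) = u s" if s: "s \<in> {t..T}" for s
  proof (rule vector_derivative_within_closed_interval[OF t_less_T s])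
    show "(y has_vector_derivative u s) (at s within {t..T})"
      unfolding y_def using has_vector_derivative_add[OF has_vector_derivative_const integral_has_vector_derivative[OF u s]]
      by simp
  qed
  define \<phi> where "\<phi> s = d t s * l (vector_derivative y (at s within {t..T}))" for s
  have eq: "\<phi> s = d t s * l (u s)" if "s \<in> {t..T}" for s using vd[OF that] by (simp add: \<phi>_def)
  have "continuous_on {t..T} \<phi>"
    by (rule continuous_on_eq[OF continuous_running_integrand[OF u]]) (simp add: eq)
  then have int\<phi>: "integrable (lebesgue_on {t..T}) \<phi>" by (rule continuous_imp_integrable_real)
  have "integral\<^sup>L (lebesgue_on {t..T}) \<phi> = integral {t..T} \<phi>"
    by (rule lebesgue_integral_eq_integral[OF int\<phi>]) simp
  also have "\<dots> = running u" unfolding running_def using eq by (intro integral_cong) auto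
  finally show "cost T l g d t y = ereal (running u + d t T * g (x + integral {t..T} u))"
    unfolding cost_def \<phi>_def[symmetric] extended_integral_integrable[OF int\<phi>] by (simp add: y_def)
qed

text \<open>\<open>ctrl_maximizes\<close> is integrated along the derivative \<open>f\<close> of
  \<open>y\<close>. The terms \<open>p \<bullet> f s\<close> and \<open>p \<bullet> ctrl p s\<close>
  have equal integrals, since both curves have the same displacement, so only the running costs
  remain. If the positive part of the running integral is infinite, so is the cost.\<close>

lemma cost_ge_extremal_cost:
  assumes y: "y \<in> AC T x t" and p: "displacement p = y T - x"
  shows "ereal (extremal_cost x p) \<le> cost T l g d t y"
proof -
  define f where "f s = vector_derivative y (at s within {t..T})" for s
  define \<phi> where "\<phi> s = d t s * l (f s)" for s
  have ac: "absolutely_continuous_on_interval t T y" and "y t = x"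
    using y by (auto simp: AC_def)
  have f: "(f has_integral displacement p) {t..T}"
    using absolutely_continuous_has_integral_vector_derivative[OF ac less_imp_le[OF t_less_T]] p \<open>y t = x\<close>
    by (simp add: f_def[abs_def])
  have "f \<in> borel_measurable (lebesgue_on {t..T})"
    using f by (intro integrable_imp_measurable) (auto simp: integrable_on_def)
  then have "(\<lambda>s. l (f s)) \<in> borel_measurable (lebesgue_on {t..T})"
    by (rule measurable_compose) (rule borel_measurable_continuous_onI[OF continuous])
  moreover have "d t \<in> borel_measurable (lebesgue_on {t..T})"
    by (rule continuous_imp_measurable_on_sets_lebesgue[OF continuous_discount]) simp
  ultimately have meas: "\<phi> \<in> borel_measurable (lebesgue_on {t..T})"
    unfolding \<phi>_def by (intro borel_measurable_times)
  \<comment> \<open>Slope \<open>0\<close> in \<open>lower_bound\<close>: \<open>l\<close> is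
    bounded below, so the negative part of the running integral is finite.\<close>
  obtain C where C: "\<And>u. 0 * norm u - C \<le> l u" using lower_bound by metis
  have "- \<phi> s \<le> \<bar>C\<bar>" if s: "s \<in> {t..T}" for s
  proof -
    have "d t s * - l (f s) \<le> d t s * \<bar>C\<bar>"
      using C[of "f s"] discount_pos[OF s] by (intro mult_left_mono) auto
    also have "\<dots> \<le> 1 * \<bar>C\<bar>" using discount_bounds[OF s] by (intro mult_right_mono) auto
    finally show ?thesis by (simp add: \<phi>_def)
  qed
  then have "(\<integral>\<^sup>+ s. ennreal (- \<phi> s) \<partial>lebesgue_on {t..T}) \<le> (\<integral>\<^sup>+ s. ennreal \<bar>C\<bar> \<partial>lebesgue_on {t..T})"
    by (intro nn_integral_mono ennreal_leI) (auto simp: space_restrict_space)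
  also have "\<dots> < \<infinity>"
    by (simp add: space_restrict_space emeasure_restrict_space ennreal_mult_less_top emeasure_lborel_Icc_eq)
  finally have neg: "(\<integral>\<^sup>+ s. ennreal (- \<phi> s) \<partial>lebesgue_on {t..T}) < \<infinity>" .
  have cost_eq: "cost T l g d t y = extended_integral (lebesgue_on {t..T}) \<phi> + ereal (d t T * g (y T))"
    by (simp add: cost_def \<phi>_def[abs_def] f_def)
  show ?thesis
  proof (cases "(\<integral>\<^sup>+ s. ennreal (\<phi> s) \<partial>lebesgue_on {t..T}) = \<infinity>")
    case True
    obtain q where "(\<integral>\<^sup>+ s. ennreal (- \<phi> s) \<partial>lebesgue_on {t..T}) = ennreal q" "q \<ge> 0"
      using neg by (cases "\<integral>\<^sup>+ s. ennreal (- \<phi> s) \<partial>lebesgue_on {t..T}") auto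
    then show ?thesis unfolding cost_eq extended_integral_def True by simp
  next
    case False
    then have int\<phi>: "integrable (lebesgue_on {t..T}) \<phi>"
      unfolding real_integrable_def using meas neg by auto
    have has_int\<phi>: "(\<phi> has_integral (integral\<^sup>L (lebesgue_on {t..T}) \<phi>)) {t..T}"
      by (rule has_integral_integral_lebesgue_on[OF int\<phi>]) simp
    have has_int_lower: "((\<lambda>s. (d t s * l (ctrl p s) - p \<bullet> ctrl p s) + p \<bullet> f s) has_integral
        (running (ctrl p) - p \<bullet> displacement p) + p \<bullet> displacement p) {t..T}"
    proof (intro has_integral_add has_integral_diff)
      show "((\<lambda>s. d t s * l (ctrl p s)) has_integral running (ctrl p)) {t..T}"
        unfolding running_def
        by (intro integrable_integral integrable_continuous_real continuous_running_integrand continuous_ctrl)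
      show "((\<lambda>s. p \<bullet> ctrl p s) has_integral p \<bullet> displacement p) {t..T}"
        unfolding integral_inner_ctrl[symmetric]
        by (intro integrable_integral integrable_continuous_real continuous_on_inner continuous_on_const continuous_ctrl)
      show "((\<lambda>s. p \<bullet> f s) has_integral p \<bullet> displacement p) {t..T}"
        using has_integral_linear[OF f bounded_linear_inner_right] by (simp add: o_def)
    qed
    have "(running (ctrl p) - p \<bullet> displacement p) + p \<bullet> displacement p \<le> integral\<^sup>L (lebesgue_on {t..T}) \<phi>"
    proof (rule has_integral_le[OF has_int_lower has_int\<phi>])
      fix s assume "s \<in> {t..T}"
      from ctrl_maximizes[OF this, of p "f s"]
      show "d t s * l (ctrl p s) - p \<bullet> ctrl p s + p \<bullet> f s \<le> \<phi> s" by (simp add: \<phi>_def)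
    qed
    then show ?thesis
      unfolding cost_eq extended_integral_integrable[OF int\<phi>] by (simp add: extremal_cost_def p)
  qed
qed

text \<open>Growth is first obtained in the integral of \<open>norm (ctrl p s)\<close>, where the
  running cost outweighs the Lipschitz terminal cost. A bound on this integral yields one time
  \<open>s\<close> with a bounded control, and then
  \<open>p = d t s *\<^sub>R gradient l (ctrl p s)\<close> is bounded as well.\<close>

lemma extremal_cost_attains_inf: "\<exists>p. \<forall>q. extremal_cost x p \<le> extremal_cost x q"
proof -
  have L: "L \<ge> 0" using Lipschitz by (rule lipschitz_on_nonneg)
  \<comment> \<open>After multiplication by the discount, which exceeds \<open>a\<close>, the slope
    is still at least \<open>L + 1\<close>: \<open>L\<close> absorbs the variation of
    \<open>g\<close>, and \<open>1\<close> remains for coercivity.\<close>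
  obtain C where C: "\<And>u. ((L + 1) / a) * norm u - C \<le> l u" using lower_bound by metis
  have coercive: "integral {t..T} (\<lambda>s. norm (ctrl p s)) - (T - t) * \<bar>C\<bar> - \<bar>g x\<bar> \<le> extremal_cost x p" for p
  proof -
    define N where "N = integral {t..T} (\<lambda>s. norm (ctrl p s))"
    have intN: "(\<lambda>s. norm (ctrl p s)) integrable_on {t..T}"
      by (intro integrable_continuous_real continuous_on_norm continuous_ctrl)
    have "(L + 1) * N - (T - t) * \<bar>C\<bar> = integral {t..T} (\<lambda>s. (L + 1) * norm (ctrl p s) - \<bar>C\<bar>)"
      using has_integral_diff[OF has_integral_mult_right[OF integrable_integral[OF intN], of "L + 1"]
          has_integral_const_real[of "\<bar>C\<bar>" t T]] t_less_T
      by (intro integral_unique[symmetric]) (simp add: N_def)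
    also have "\<dots> \<le> running (ctrl p)"
      unfolding running_def
    proof (rule integral_le)
      show "(\<lambda>s. (L + 1) * norm (ctrl p s) - \<bar>C\<bar>) integrable_on {t..T}"
        by (intro integrable_continuous_real continuous_on_diff continuous_on_mult continuous_on_const
            continuous_on_norm continuous_ctrl)
      show "(\<lambda>s. d t s * l (ctrl p s)) integrable_on {t..T}"
        by (intro integrable_continuous_real continuous_running_integrand continuous_ctrl)
      fix s assume s: "s \<in> {t..T}"
      have "(L + 1) * norm (ctrl p s) = a * (((L + 1) / a) * norm (ctrl p s))" using a_pos by simp
      also have "\<dots> \<le> d t s * (((L + 1) / a) * norm (ctrl p s))"
        using discount_bounds[OF s] a_pos L by (intro mult_right_mono) auto
      finally have 1: "(L + 1) * norm (ctrl p s) \<le> d t s * (((L + 1) / a) * norm (ctrl p s))" .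
      have "d t s * C \<le> d t s * \<bar>C\<bar>" using discount_pos[OF s] by (intro mult_left_mono) auto
      also have "\<dots> \<le> 1 * \<bar>C\<bar>" using discount_bounds[OF s] by (intro mult_right_mono) auto
      finally have 2: "d t s * C \<le> \<bar>C\<bar>" by simp
      have "d t s * (((L + 1) / a) * norm (ctrl p s) - C) \<le> d t s * l (ctrl p s)"
        using discount_pos[OF s] C by (intro mult_left_mono) auto
      with 1 2 show "(L + 1) * norm (ctrl p s) - \<bar>C\<bar> \<le> d t s * l (ctrl p s)"
        by (simp only: right_diff_distrib)
    qed
    finally have 1: "(L + 1) * N - (T - t) * \<bar>C\<bar> \<le> running (ctrl p)" .
    have "norm (displacement p) \<le> N"
      unfolding displacement_def N_def
      by (rule integral_norm_bound_integral)
        (auto intro!: integrable_continuous_real continuous_on_norm continuous_ctrl)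
    then have "L * norm (displacement p) \<le> L * N" using L by (rule mult_left_mono)
    moreover have "\<bar>g (x + displacement p) - g x\<bar> \<le> L * norm (displacement p)"
      using lipschitz_onD[OF Lipschitz, of "x + displacement p" x] by (simp add: dist_norm)
    ultimately have "\<bar>g (x + displacement p)\<bar> \<le> \<bar>g x\<bar> + L * N" by linarith
    moreover have "\<bar>d t T * g (x + displacement p)\<bar> \<le> 1 * \<bar>g (x + displacement p)\<bar>"
      unfolding abs_mult using discount_bounds[of T] a_pos t_less_T by (intro mult_right_mono) auto
    ultimately have 2: "- \<bar>g x\<bar> - L * N \<le> d t T * g (x + displacement p)" by linarith
    show ?thesis
      unfolding N_def[symmetric] extremal_cost_def using 1 2 by (simp add: algebra_simps)
  qed
  define R where "R = extremal_cost x 0 + (T - t) * \<bar>C\<bar> + \<bar>g x\<bar>"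
  \<comment> \<open>If \<open>norm (ctrl p s)\<close> were at least \<open>\<rho>\<close> for all
    \<open>s\<close>, its integral would be at least \<open>\<bar>R\<bar> + (T - t)\<close>, more
    than the bound \<open>R\<close> from coercivity.\<close>
  define \<rho> where "\<rho> = \<bar>R\<bar> / (T - t) + 1"
  have "compact (gradient l ` cball 0 \<rho>)"
    using continuous_gradient by (intro compact_continuous_image) (auto intro: continuous_on_subset)
  then have "bounded (gradient l ` cball 0 \<rho>)" by (rule compact_imp_bounded)
  then obtain G where "\<forall>z\<in>gradient l ` cball 0 \<rho>. norm z \<le> G" unfolding bounded_iff by blast
  then have G: "norm (gradient l u) \<le> G" if "norm u \<le> \<rho>" for u using that by auto
  have "norm p \<le> G" if p: "extremal_cost x p \<le> extremal_cost x 0" for p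
  proof -
    have "\<exists>s\<in>{t..T}. norm (ctrl p s) \<le> \<rho>"
    proof (rule ccontr)
      assume "\<not> ?thesis"
      then have big: "\<rho> \<le> norm (ctrl p s)" if "s \<in> {t..T}" for s
        using that by (metis less_imp_le not_le)
      have "(T - t) * \<rho> = integral {t..T} (\<lambda>s. \<rho>)" using t_less_T by simp
      also have "\<dots> \<le> integral {t..T} (\<lambda>s. norm (ctrl p s))"
        by (intro integral_le integrable_continuous_real continuous_on_norm continuous_ctrl continuous_on_const big)
      also have "\<dots> \<le> R" using coercive[of p] p by (simp add: R_def)
      finally have "\<bar>R\<bar> + (T - t) \<le> R" using t_less_T by (simp add: \<rho>_def distrib_left)
      then show False using t_less_T by simp
    qed
    then obtain s where s: "s \<in> {t..T}" "norm (ctrl p s) \<le> \<rho>" by blast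
    have "norm p = d t s * norm (gradient l (ctrl p s))"
      using arg_cong[OF gradient_ctrl[OF s(1), of p], of norm] discount_pos[OF s(1)] by simp
    also have "\<dots> \<le> 1 * norm (gradient l (ctrl p s))"
      using discount_bounds[OF s(1)] by (intro mult_right_mono) auto
    also have "\<dots> \<le> G" using G[OF s(2)] by simp
    finally show ?thesis .
  qed
  then have bdd: "bounded {p. extremal_cost x p \<le> extremal_cost x 0}" by (auto simp: bounded_iff)
  have "continuous_on UNIV (\<lambda>p. g (x + displacement p))"
    by (rule continuous_on_compose2[OF continuous_g]) (auto intro!: continuous_intros continuous_displacement)
  then have "continuous_on UNIV (extremal_cost x)"
    unfolding extremal_cost_def[abs_def]
    by (intro continuous_on_add continuous_on_mult continuous_on_const continuous_running_ctrl)
  from bounded_sublevel_attains_inf[OF this bdd] show ?thesis by metis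
qed

text \<open>Each admissible curve is compared with the extremal having the same end points, so the
  infimum over curves is the minimum over \<open>p\<close>. Being finite, it survives the conversion
  to \<open>real\<close>.\<close>

lemma value_attained:
  obtains p where "(INF y\<in>AC T x t. cost T l g d t y) = ereal (extremal_cost x p)"
    "value_function T l g d x t = extremal_cost x p"
proof -
  obtain p where p: "\<And>q. extremal_cost x p \<le> extremal_cost x q"
    using extremal_cost_attains_inf by metis
  have inf: "(INF y\<in>AC T x t. cost T l g d t y) = ereal (extremal_cost x p)"
  proof (rule antisym)
    have "(INF y\<in>AC T x t. cost T l g d t y) \<le> cost T l g d t (\<lambda>s. x + integral {t..s} (ctrl p))"
      by (rule INF_lower[OF cost_of_control(1)[OF continuous_ctrl]])
    also have "\<dots> = ereal (extremal_cost x p)"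
      unfolding cost_of_control(2)[OF continuous_ctrl] extremal_cost_def displacement_def ..
    finally show "(INF y\<in>AC T x t. cost T l g d t y) \<le> ereal (extremal_cost x p)" .
    show "ereal (extremal_cost x p) \<le> (INF y\<in>AC T x t. cost T l g d t y)"
    proof (rule INF_greatest)
      fix y assume y: "y \<in> AC T x t"
      obtain q where q: "displacement q = y T - x" using surj_displacement by blast
      have "ereal (extremal_cost x p) \<le> ereal (extremal_cost x q)" using p by simp
      also have "\<dots> \<le> cost T l g d t y" by (rule cost_ge_extremal_cost[OF y q])
      finally show "ereal (extremal_cost x p) \<le> cost T l g d t y" .
    qed
  qed
  then show ?thesis by (intro that[of p]) (auto simp: value_function_def)
qed

lemma value_le:
  assumes "continuous_on {t..T} u"
  shows "value_function T l g d x t \<le> running u + d t T * g (x + integral {t..T} u)"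
proof -
  obtain p where p: "(INF y\<in>AC T x t. cost T l g d t y) = ereal (extremal_cost x p)"
    "value_function T l g d x t = extremal_cost x p" using value_attained by metis
  have "ereal (extremal_cost x p) \<le> cost T l g d t (\<lambda>s. x + integral {t..s} u)"
    unfolding p(1)[symmetric] by (rule INF_lower[OF cost_of_control(1)[OF assms]])
  also have "\<dots> = ereal (running u + d t T * g (x + integral {t..T} u))"
    by (rule cost_of_control(2)[OF assms])
  finally show ?thesis using p(2) by simp
qed

end

section \<open>Derivatives of the value function\<close>

text \<open>From \<open>x + h *\<^sub>R e\<close> the same end point is reached with the control \<open>ctrl p s - (h / (T - t)) *\<^sub>R e\<close>,
  so that the terminal cost is unchanged and \<open>g\<close> need not be differentiated.\<close>

lemma (in discounted_problem) value_derivative: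
  assumes attained: "value_function T l g d x t = extremal_cost x p"
    and D: "((\<lambda>z. value_function T l g d z t) has_derivative D) (at x)"
  shows "D e = - (e \<bullet> p)"
proof -
  \<comment> \<open>One inequality for all directions suffices: by linearity of \<open>D\<close>,
    its instances at \<open>e\<close> and \<open>- e\<close> give equality.\<close>
  have le: "D e \<le> - (e \<bullet> p)" for e
  proof -
    define v where "v z = value_function T l g d z t" for z
    define k where "k = 1 / (T - t)"
    have "k > 0" "k * (T - t) = 1" using t_less_T by (auto simp: k_def)
    define u where "u h s = ctrl p s - (k * h) *\<^sub>R e" for h s
    \<comment> \<open>The gradient is taken at the shifted control \<open>u h\<close>, because the
      tangent inequality based there bounds the increase of the running cost from above.\<close>
    define \<Phi> where "\<Phi> h = integral {t..T} (\<lambda>s. d t s * (gradient l (u h s) \<bullet> e))" for h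
    have cont_u: "continuous_on {t..T} (u h)" for h
      unfolding u_def by (intro continuous_on_diff continuous_on_const continuous_ctrl)
    have cont_\<Phi>: "continuous_on {t..T} (\<lambda>s. d t s * (gradient l (u h s) \<bullet> e))" for h
      by (intro continuous_on_mult continuous_discount continuous_on_inner continuous_on_const
          continuous_on_compose2[OF continuous_gradient cont_u]) auto
    have upper: "(v (x + h *\<^sub>R e) - v x) / h \<le> - k * \<Phi> h" if "h > 0" for h
    proof -
      have "integral {t..T} (u h) = displacement p - h *\<^sub>R e"
      proof -
        have "integral {t..T} (u h) = displacement p - integral {t..T} (\<lambda>s. (k * h) *\<^sub>R e)"
          unfolding u_def displacement_def
          by (intro integral_diff integrable_continuous_real continuous_ctrl continuous_on_const)
        also have "integral {t..T} (\<lambda>s. (k * h) *\<^sub>R e) = ((k * (T - t)) * h) *\<^sub>R e"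
          using t_less_T by (simp add: mult.commute mult.left_commute)
        finally show ?thesis using \<open>k * (T - t) = 1\<close> by simp
      qed
      then have "v (x + h *\<^sub>R e) \<le> running (u h) + d t T * g (x + displacement p)"
        using value_le[OF cont_u, of "x + h *\<^sub>R e" h] by (simp add: v_def algebra_simps)
      moreover have "v x = running (ctrl p) + d t T * g (x + displacement p)"
        using attained by (simp add: v_def extremal_cost_def)
      moreover have "running (u h) - running (ctrl p) \<le> - (k * h) * \<Phi> h"
      proof -
        have "running (u h) - running (ctrl p) = integral {t..T} (\<lambda>s. d t s * l (u h s) - d t s * l (ctrl p s))"
          unfolding running_def
          by (intro integral_diff[symmetric] integrable_continuous_real continuous_running_integrand cont_u continuous_ctrl)
        also have "\<dots> \<le> integral {t..T} (\<lambda>s. - (k * h) * (d t s * (gradient l (u h s) \<bullet> e)))"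
        proof (rule integral_le)
          fix s assume s: "s \<in> {t..T}"
          have "l (u h s) - l (ctrl p s) \<le> - (k * h) * (gradient l (u h s) \<bullet> e)"
            using tangent_le[of "u h s" "ctrl p s"] by (simp add: u_def)
          then have "d t s * (l (u h s) - l (ctrl p s)) \<le> d t s * (- (k * h) * (gradient l (u h s) \<bullet> e))"
            using discount_pos[OF s] by (intro mult_left_mono) auto
          then show "d t s * l (u h s) - d t s * l (ctrl p s) \<le> - (k * h) * (d t s * (gradient l (u h s) \<bullet> e))"
            by (simp add: right_diff_distrib mult.left_commute)
        qed (intro integrable_continuous_real continuous_on_diff continuous_running_integrand cont_u continuous_ctrl
            continuous_on_mult[OF continuous_on_const] cont_\<Phi>)+
        also have "\<dots> = - (k * h) * \<Phi> h" unfolding \<Phi>_def by (rule integral_mult_right)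
        finally show ?thesis .
      qed
      ultimately have "v (x + h *\<^sub>R e) - v x \<le> - (k * h) * \<Phi> h" by linarith
      also have "\<dots> = (- k * \<Phi> h) * h" by simp
      finally have "v (x + h *\<^sub>R e) - v x \<le> (- k * \<Phi> h) * h" .
      then show ?thesis using that by (simp add: pos_divide_le_eq)
    qed
    have \<Phi>0: "\<Phi> 0 = (T - t) * (e \<bullet> p)"
    proof -
      have "\<Phi> 0 = integral {t..T} (\<lambda>s. e \<bullet> p)"
        unfolding \<Phi>_def
      proof (rule integral_cong)
        fix s assume s: "s \<in> {t..T}"
        have "d t s * (gradient l (ctrl p s) \<bullet> e) = (d t s *\<^sub>R gradient l (ctrl p s)) \<bullet> e" by simp
        also have "\<dots> = e \<bullet> p" unfolding gradient_ctrl[OF s] by (rule inner_commute)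
        finally show "d t s * (gradient l (u 0 s) \<bullet> e) = e \<bullet> p" by (simp add: u_def)
      qed
      then show ?thesis using t_less_T by simp
    qed
    have "continuous_on UNIV \<Phi>"
    proof -
      have "continuous_on ((UNIV :: real set) \<times> {t..T}) (\<lambda>q. d t (snd q))"
        by (rule continuous_on_compose2[OF continuous_discount continuous_on_snd[OF continuous_on_id]]) auto
      moreover have "continuous_on ((UNIV :: real set) \<times> {t..T}) (\<lambda>q. u (fst q) (snd q))"
        unfolding u_def
        by (intro continuous_intros continuous_on_compose2[OF continuous_ctrl continuous_on_snd[OF continuous_on_id]]) auto
      then have "continuous_on ((UNIV :: real set) \<times> {t..T}) (\<lambda>q. gradient l (u (fst q) (snd q)))"
        by (rule continuous_on_compose2[OF continuous_gradient]) auto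
      ultimately have "continuous_on ((UNIV :: real set) \<times> {t..T}) (\<lambda>(h, s). d t s * (gradient l (u h s) \<bullet> e))"
        unfolding split_beta by (intro continuous_on_mult continuous_on_inner continuous_on_const)
      then show ?thesis
        using integral_continuous_on_param[of UNIV t T "\<lambda>h s. d t s * (gradient l (u h s) \<bullet> e)"]
        by (simp add: \<Phi>_def)
    qed
    then have "isCont \<Phi> 0" by (simp add: continuous_on_eq_continuous_at)
    then have "(\<Phi> \<longlongrightarrow> \<Phi> 0) (at_right 0)" by (simp add: isCont_def filterlim_at_split)
    then have lim_upper: "((\<lambda>h. - k * \<Phi> h) \<longlongrightarrow> - k * \<Phi> 0) (at_right 0)"
      by (intro tendsto_intros)
    have lim_lower: "((\<lambda>h. (v (x + h *\<^sub>R e) - v x) / h) \<longlongrightarrow> D e) (at_right 0)"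
    proof -
      have lin: "linear D" using D by (rule has_derivative_linear)
      have "((\<lambda>h. v (x + h *\<^sub>R e)) has_derivative (\<lambda>h. D (h *\<^sub>R e))) (at 0)"
        by (rule has_derivative_compose[of "\<lambda>h. x + h *\<^sub>R e" _ 0 UNIV v])
          (use D in \<open>auto intro!: derivative_eq_intros simp: v_def[abs_def]\<close>)
      moreover have "(\<lambda>h. D (h *\<^sub>R e)) = (*) (D e)"
        by (rule ext) (simp add: linear_scale[OF lin] mult.commute)
      ultimately have "((\<lambda>h. v (x + h *\<^sub>R e)) has_field_derivative D e) (at 0)"
        by (simp only: has_field_derivative_def)
      from DERIV_D[OF this] show ?thesis by (simp add: filterlim_at_split)
    qed
    have "D e \<le> - k * \<Phi> 0"
    proof (rule tendsto_le[OF _ lim_upper lim_lower])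
      have "eventually (\<lambda>h. h \<in> {0<..<1}) (at_right (0::real))" by (rule eventually_at_right_real) simp
      then show "\<forall>\<^sub>F h in at_right 0. (v (x + h *\<^sub>R e) - v x) / h \<le> - k * \<Phi> h"
        by eventually_elim (rule upper, simp)
    qed simp
    also have "- k * \<Phi> 0 = - ((k * (T - t)) * (e \<bullet> p))" using \<Phi>0 by simp
    finally show ?thesis using \<open>k * (T - t) = 1\<close> by simp
  qed
  have "D (- e) = - D e" using has_derivative_linear[OF D] by (rule linear_neg)
  with le[of e] le[of "- e"] show ?thesis by simp
qed

section \<open>Differentiation in the initial time and the Hamilton-Jacobi equation\<close>

lemma DERIV_zero_if_quadratic:
  fixes f :: "real \<Rightarrow> real"
  assumes "open S" "t \<in> S" "f t = 0" and bound: "\<And>\<tau>. \<tau> \<in> S \<Longrightarrow> \<bar>f \<tau>\<bar> \<le> C * (\<tau> - t)\<^sup>2"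
  shows "(f has_real_derivative 0) (at t)"
proof -
  have "((\<lambda>\<tau>. (f \<tau> - f t) / (\<tau> - t)) \<longlongrightarrow> 0) (at t within S)"
  proof (rule Lim_null_comparison)
    show "\<forall>\<^sub>F \<tau> in at t within S. norm ((f \<tau> - f t) / (\<tau> - t)) \<le> C * \<bar>\<tau> - t\<bar>"
      unfolding eventually_at_filter
    proof (intro always_eventually allI impI)
      fix \<tau> assume "\<tau> \<noteq> t" "\<tau> \<in> S"
      with bound[OF this(2)] \<open>f t = 0\<close> show "norm ((f \<tau> - f t) / (\<tau> - t)) \<le> C * \<bar>\<tau> - t\<bar>"
        by (simp add: pos_divide_le_eq power2_eq_square mult.assoc)
    qed
    have "((\<lambda>\<tau>. C * \<bar>\<tau> - t\<bar>) \<longlongrightarrow> C * \<bar>t - t\<bar>) (at t within S)" by (intro tendsto_intros)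
    then show "((\<lambda>\<tau>. C * \<bar>\<tau> - t\<bar>) \<longlongrightarrow> 0) (at t within S)" by simp
  qed
  then show ?thesis
    using at_within_open[OF assms(2,1)] by (simp add: has_field_derivative_iff)
qed

locale time_dependent_discount = superlinear_cost l
  for l :: "real^'n \<Rightarrow> real" +
  fixes g :: "real^'n \<Rightarrow> real" and d :: "real \<Rightarrow> real \<Rightarrow> real" and a T L K :: real
  assumes Lipschitz_g: "L-lipschitz_on UNIV g"
    and a_pos: "a > 0"
    and bounds: "\<And>t s. t \<in> {0..T} \<Longrightarrow> s \<in> {0..T} \<Longrightarrow> d t s \<in> {a<..1}"
    and Lipschitz_d: "K-lipschitz_on ({0..T} \<times> {0..T}) (\<lambda>(t, s). d t s)"
    and diagonal: "\<And>t. t \<in> {0..T} \<Longrightarrow> d t t = 1"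
    and differentiable_d: "\<And>t s. 0 \<le> t \<Longrightarrow> t \<le> s \<Longrightarrow> s \<le> T \<Longrightarrow> (\<lambda>\<tau>. d \<tau> s) differentiable (at t within {0..s})"
    and integrable_d_dt: "\<And>t. t \<in> {0..T} \<Longrightarrow> set_integrable lebesgue {t..T} (\<lambda>s. d_dt d t s)"
begin

lemma Lipschitz_first:
  assumes "t \<in> {0..T}" "t' \<in> {0..T}" "s \<in> {0..T}"
  shows "\<bar>d t s - d t' s\<bar> \<le> K * \<bar>t - t'\<bar>"
  using lipschitz_onD[OF Lipschitz_d, of "(t, s)" "(t', s)"] assms
  by (simp add: dist_Pair_Pair dist_real_def)

lemma Lipschitz_second:
  assumes "t \<in> {0..T}" "s \<in> {0..T}" "s' \<in> {0..T}"
  shows "\<bar>d t s - d t s'\<bar> \<le> K * \<bar>s - s'\<bar>"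
  using lipschitz_onD[OF Lipschitz_d, of "(t, s)" "(t, s')"] assms
  by (simp add: dist_Pair_Pair dist_real_def)

lemma continuous_d: "t \<in> {0..T} \<Longrightarrow> continuous_on {0..T} (d t)"
  using Lipschitz_second[of t] lipschitz_on_nonneg[OF Lipschitz_d]
  by (intro lipschitz_on_continuous_on[of K] lipschitz_onI) (auto simp: dist_real_def)

lemma problem_at: "t \<in> {0..<T} \<Longrightarrow> discounted_problem l g d a t T L"
proof
  assume t: "t \<in> {0..<T}"
  show "continuous_on {t..T} (d t)"
    using continuous_d[of t] t by (auto intro: continuous_on_subset)
  show "a < d t s \<and> d t s \<le> 1" if "s \<in> {t..T}" for s
    using bounds[of t s] t that by auto
qed (use Lipschitz_g a_pos in auto)

text \<open>For \<open>0 < t < s\<close> the interval \<open>{0..s}\<close> is a neighbourhood of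
  \<open>t\<close>, so the derivative in \<open>d_dt\<close> is two-sided.\<close>

lemma DERIV_d:
  assumes "0 < t" "t < s" "s \<le> T"
  shows "((\<lambda>\<tau>. d \<tau> s) has_real_derivative d_dt d t s) (at t)"
proof -
  have at: "at t within {0..s} = at t" using assms by (intro at_within_Icc_at) auto
  have "(\<lambda>\<tau>. d \<tau> s) differentiable (at t)"
    using differentiable_d[of t s] assms by (simp add: at)
  then show ?thesis
    unfolding d_dt_def at by (simp add: vector_derivative_works has_real_derivative_iff_has_vector_derivative)
qed

text \<open>Leibniz rule with \<open>\<tau>\<close> in both the lower limit and the integrand.
  \<open>A\<close> keeps the interval fixed and is differentiated by dominated convergence;
  \<open>B\<close> moves the limit with the discount replaced by its diagonal value
  \<open>1\<close>. In the error \<open>E\<close> an integrand of order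
  \<open>\<bar>\<tau> - t\<bar>\<close> is integrated over an interval of length
  \<open>\<bar>\<tau> - t\<bar>\<close>.\<close>

lemma DERIV_running_cost:
  assumes c: "continuous_on {0..T} c" and t: "0 < t" "t < T"
  shows "((\<lambda>\<tau>. integral {\<tau>..T} (\<lambda>s. d \<tau> s * c s)) has_real_derivative
    (LINT s:{t..T}|lebesgue. d_dt d t s * c s) - c t) (at t)"
proof -
  have "compact (c ` {0..T})" using c by (intro compact_continuous_image) auto
  then have "bounded (c ` {0..T})" by (rule compact_imp_bounded)
  then obtain M where "\<forall>z\<in>c ` {0..T}. norm z \<le> M" unfolding bounded_iff by blast
  then have M: "\<bar>c s\<bar> \<le> M" if "s \<in> {0..T}" for s using that by auto
  have "M \<ge> 0" using M[of t] t by auto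
  have "K \<ge> 0" using Lipschitz_d by (rule lipschitz_on_nonneg)
  have cont_dc: "continuous_on S (\<lambda>s. d \<tau> s * c s)" if "S \<subseteq> {0..T}" "\<tau> \<in> {0..T}" for \<tau> S
    using continuous_on_mult[OF continuous_d c] that by (auto intro: continuous_on_subset)
  define A where "A \<tau> = integral {t..T} (\<lambda>s. d \<tau> s * c s)" for \<tau>
  define B where "B \<tau> = integral {\<tau>..T} c" for \<tau>
  define k where "k \<tau> s = (d \<tau> s - 1) * c s" for \<tau> s
  define E where "E \<tau> = integral {\<tau>..T} (k \<tau>) - integral {t..T} (k \<tau>)" for \<tau>
  have cont_k: "continuous_on S (k \<tau>)" if "S \<subseteq> {0..T}" "\<tau> \<in> {0..T}" for \<tau> S
    unfolding k_def using that c continuous_d[of \<tau>]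
    by (intro continuous_on_mult continuous_on_diff continuous_on_const) (auto intro: continuous_on_subset)
  have split: "integral {\<tau>..T} (\<lambda>s. d \<tau> s * c s) = A \<tau> + (B \<tau> - B t) + E \<tau>" if \<tau>: "\<tau> \<in> {0<..<T}" for \<tau>
  proof -
    have "integral {r..T} (\<lambda>s. d \<tau> s * c s) = integral {r..T} c + integral {r..T} (k \<tau>)" if "r \<in> {0..T}" for r
    proof -
      have "integral {r..T} (\<lambda>s. d \<tau> s * c s) = integral {r..T} (\<lambda>s. c s + k \<tau> s)"
        by (simp add: k_def algebra_simps)
      also have "\<dots> = integral {r..T} c + integral {r..T} (k \<tau>)"
        using that \<tau> c cont_k[of "{r..T}" \<tau>]
        by (intro integral_add integrable_continuous_real) (auto intro: continuous_on_subset)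
      finally show ?thesis .
    qed
    from this[of \<tau>] this[of t] show ?thesis using \<tau> t by (simp add: A_def B_def E_def)
  qed
  have E: "(E has_real_derivative 0) (at t)"
  proof (rule DERIV_zero_if_quadratic[of "{0<..<T}"])
    fix \<tau> assume \<tau>: "\<tau> \<in> {0<..<T}"
    have bound_k: "norm (k \<tau> s) \<le> K * M * \<bar>\<tau> - t\<bar>" if "s \<in> {min \<tau> t..max \<tau> t}" for s
    proof -
      have s: "s \<in> {0..T}" "\<bar>s - \<tau>\<bar> \<le> \<bar>\<tau> - t\<bar>" using that \<tau> t by auto
      have "\<bar>d \<tau> s - 1\<bar> \<le> K * \<bar>s - \<tau>\<bar>"
        using Lipschitz_second[of \<tau> s \<tau>] diagonal[of \<tau>] s \<tau> by simp
      also have "\<dots> \<le> K * \<bar>\<tau> - t\<bar>" using s \<open>K \<ge> 0\<close> by (intro mult_left_mono)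
      finally have "\<bar>d \<tau> s - 1\<bar> * \<bar>c s\<bar> \<le> (K * \<bar>\<tau> - t\<bar>) * M"
        using M[OF s(1)] \<open>K \<ge> 0\<close> by (intro mult_mono) auto
      then show ?thesis by (simp add: k_def abs_mult mult_ac)
    qed
    have "norm (integral {min \<tau> t..max \<tau> t} (k \<tau>)) \<le> K * M * \<bar>\<tau> - t\<bar> * (max \<tau> t - min \<tau> t)"
      using \<tau> t by (intro integral_bound cont_k bound_k) auto
    moreover have "\<bar>E \<tau>\<bar> = \<bar>integral {min \<tau> t..max \<tau> t} (k \<tau>)\<bar>"
    proof -
      have int: "k \<tau> integrable_on {r..T}" if "r \<in> {0..T}" for r
        using that \<tau> by (intro integrable_continuous_real cont_k) auto
      show ?thesis
      proof (cases "\<tau> \<le> t")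
        case True
        then show ?thesis
          using Henstock_Kurzweil_Integration.integral_combine[OF True _ int] \<tau> t by (simp add: E_def)
      next
        case False
        then show ?thesis
          using Henstock_Kurzweil_Integration.integral_combine[of t \<tau> T "k \<tau>"] int[of t] \<tau> t by (simp add: E_def)
      qed
    qed
    moreover have "max \<tau> t - min \<tau> t = \<bar>\<tau> - t\<bar>" by simp
    ultimately have "\<bar>E \<tau>\<bar> \<le> K * M * (\<bar>\<tau> - t\<bar> * \<bar>\<tau> - t\<bar>)"
      by (simp only: real_norm_def mult.assoc)
    then show "\<bar>E \<tau>\<bar> \<le> K * M * (\<tau> - t)\<^sup>2"
      by (simp add: power2_eq_square)
  qed (use t in \<open>auto simp: E_def\<close>)
  have B: "(B has_real_derivative - c t) (at t)"
  proof -
    have "(B has_real_derivative - c t) (at t within {0..T})"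
      unfolding B_def has_real_derivative_iff_has_vector_derivative
      using c t by (intro integral_has_vector_derivative') auto
    then show ?thesis using at_within_Icc_at[OF t] by simp
  qed
  have A: "(A has_real_derivative (LINT s:{t..T}|lebesgue. d_dt d t s * c s)) (at t)"
  proof -
    let ?M = "lebesgue_on {t..T}"
    have A_eq: "A \<tau> = (LINT s|?M. d \<tau> s * c s)" "integrable ?M (\<lambda>s. d \<tau> s * c s)" if "\<tau> \<in> {0..T}" for \<tau>
    proof -
      show int: "integrable ?M (\<lambda>s. d \<tau> s * c s)"
        using that t by (intro continuous_imp_integrable_real cont_dc) auto
      show "A \<tau> = (LINT s|?M. d \<tau> s * c s)"
        unfolding A_def by (rule lebesgue_integral_eq_integral[symmetric, OF int]) simp
    qed
    \<comment> \<open>Sequences make dominated convergence applicable; the Lipschitz condition in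
      the first argument bounds the integrands of the difference quotients by
      \<open>K * M\<close>.\<close>
    have "((\<lambda>\<tau>. (A \<tau> - A t) / (\<tau> - t)) \<longlongrightarrow> (LINT s|?M. d_dt d t s * c s)) (at t within {0<..<T})"
      unfolding tendsto_at_iff_sequentially
    proof (intro allI impI)
      fix X assume X: "\<forall>i. X i \<in> {0<..<T} - {t}" "X \<longlonglongrightarrow> t"
      define q where "q i s = (d (X i) s - d t s) / (X i - t) * c s" for i s
      have quotient: "(A (X i) - A t) / (X i - t) = (LINT s|?M. q i s)" for i
      proof -
        have Xi: "X i \<in> {0..T}" "t \<in> {0..T}" using X(1) t by (auto simp: less_imp_le)
        have "(LINT s|?M. q i s) = (LINT s|?M. (d (X i) s * c s - d t s * c s) / (X i - t))"
          by (simp add: q_def left_diff_distrib)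
        also have "\<dots> = (A (X i) - A t) / (X i - t)"
          using A_eq Xi by simp
        finally show ?thesis ..
      qed
      have "(\<lambda>i. LINT s|?M. q i s) \<longlonglongrightarrow> (LINT s|?M. d_dt d t s * c s)"
      proof (rule integral_dominated_convergence)
        have "c \<in> borel_measurable ?M"
          using c t by (intro continuous_imp_measurable_on_sets_lebesgue) (auto intro: continuous_on_subset)
        moreover have "integrable ?M (d_dt d t)"
          using integrable_d_dt[of t] t by (simp add: integrable_restrict_space set_integrable_def)
        ultimately show "(\<lambda>s. d_dt d t s * c s) \<in> borel_measurable ?M"
          by (intro borel_measurable_times) auto
        show "q i \<in> borel_measurable ?M" for i
        proof -
          have "X i \<in> {0..T}" using X(1) by (auto simp: less_imp_le)
          then have "continuous_on {t..T} (q i)"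
            unfolding q_def using c continuous_d[of "X i"] continuous_d[of t] t X(1)
            by (intro continuous_on_mult continuous_on_divide continuous_on_diff continuous_on_const)
              (auto intro: continuous_on_subset)
          then show ?thesis by (rule continuous_imp_measurable_on_sets_lebesgue) simp
        qed
        show "integrable ?M (\<lambda>s. K * M)" by (intro continuous_imp_integrable_real continuous_on_const)
        \<comment> \<open>At \<open>s = t\<close> the derivative in \<open>d_dt\<close> is
          one-sided, so this single point is discarded.\<close>
        have "AE s in lebesgue. s \<noteq> t"
          by (rule AE_completion[OF AE_lborel_singleton])
        then have "AE s in ?M. s \<noteq> t" by (subst AE_restrict_space_iff) auto
        moreover have "AE s in ?M. s \<in> {t..T}" by (rule AE_I2) (simp add: space_restrict_space)
        ultimately show "AE s in ?M. (\<lambda>i. q i s) \<longlonglongrightarrow> d_dt d t s * c s"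
        proof eventually_elim
          case (elim s)
          then have "((\<lambda>\<tau>. (d \<tau> s - d t s) / (\<tau> - t)) \<longlongrightarrow> d_dt d t s) (at t)"
            using DERIV_d[of t s] t by (simp add: has_field_derivative_iff)
          moreover have "filterlim X (at t) sequentially"
            using X by (auto simp: filterlim_at)
          ultimately have "(\<lambda>i. (d (X i) s - d t s) / (X i - t)) \<longlonglongrightarrow> d_dt d t s"
            by (rule filterlim_compose)
          then show ?case unfolding q_def by (intro tendsto_intros)
        qed
        show "AE s in ?M. norm (q i s) \<le> K * M" for i
        proof (rule AE_I2)
          fix s assume "s \<in> space ?M"
          then have s: "s \<in> {0..T}" using t by (simp add: space_restrict_space)
          have Xi: "X i \<in> {0..T}" "X i \<noteq> t" using X(1) by (auto simp: less_imp_le)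
          have "\<bar>(d (X i) s - d t s) / (X i - t)\<bar> \<le> K"
            using Lipschitz_first[of "X i" t s] s Xi t by (simp add: pos_divide_le_eq)
          then have "\<bar>(d (X i) s - d t s) / (X i - t)\<bar> * \<bar>c s\<bar> \<le> K * M"
            using M[OF s] \<open>K \<ge> 0\<close> by (intro mult_mono) auto
          then show "norm (q i s) \<le> K * M" by (simp add: q_def abs_mult)
        qed
      qed
      then show "((\<lambda>\<tau>. (A \<tau> - A t) / (\<tau> - t)) \<circ> X) \<longlonglongrightarrow> (LINT s|?M. d_dt d t s * c s)"
        by (simp add: o_def quotient)
    qed
    moreover have "(LINT s|?M. d_dt d t s * c s) = (LINT s:{t..T}|lebesgue. d_dt d t s * c s)"
      by (simp add: integral_restrict_space set_lebesgue_integral_def)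
    ultimately show ?thesis
      using at_within_open[of t "{0<..<T}"] t by (simp add: has_field_derivative_iff)
  qed
  have "((\<lambda>\<tau>. A \<tau> + (B \<tau> - B t) + E \<tau>) has_real_derivative
      (LINT s:{t..T}|lebesgue. d_dt d t s * c s) + (- c t - 0) + 0) (at t)"
    by (intro DERIV_add DERIV_diff A B E DERIV_const)
  then have "((\<lambda>\<tau>. A \<tau> + (B \<tau> - B t) + E \<tau>) has_real_derivative
      (LINT s:{t..T}|lebesgue. d_dt d t s * c s) - c t) (at t)"
    by simp
  then show ?thesis
    by (rule has_field_derivative_transform_within_open[of _ _ _ "{0<..<T}"]) (use t split in auto)
qed

theorem Hamilton_Jacobi:
  assumes t: "0 < t" "t < T"
    and diff: "(\<lambda>(z, \<tau>). value_function T l g d z \<tau>) differentiable (at (x, t))"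
  defines "v \<equiv> value_function T l g d"
  defines "v_x \<equiv> gradient (\<lambda>z. v z t) x"
  shows "- deriv (\<lambda>\<tau>. v x \<tau>) t + conjugate l (- v_x) + w T l g d x t (iota l (- v_x)) = 0"
proof -
  interpret discounted_problem l g d a t T L
    by (rule problem_at) (use t in simp)
  obtain p where p: "value_function T l g d x t = extremal_cost x p"
    using value_attained by metis
  obtain D where D: "((\<lambda>(z, \<tau>). v z \<tau>) has_derivative D) (at (x, t))"
    using diff unfolding v_def differentiable_def by blast
  have lin: "linear D" using D by (rule has_derivative_linear)
  have "((\<lambda>z. v z t) has_derivative (\<lambda>h. D (h, 0))) (at x)"
    using has_derivative_compose[OF has_derivative_Pair[OF has_derivative_ident has_derivative_const] D] by simp
  moreover from this have Dx: "D (h, 0) = - (h \<bullet> p)" for h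
    using value_derivative[OF p] unfolding v_def by blast
  ultimately have "((\<lambda>z. v z t) has_derivative (\<lambda>h. h \<bullet> - p)) (at x)" by simp
  then have v_x: "v_x = - p" unfolding v_x_def by (rule gradient_eqI)
  have "((\<lambda>\<tau>. v x \<tau>) has_derivative (\<lambda>h. D (0, h))) (at t)"
    using has_derivative_compose[OF has_derivative_Pair[OF has_derivative_const has_derivative_ident] D] by simp
  moreover have "(\<lambda>h. D (0, h)) = (*) (D (0, 1))"
  proof
    fix h
    show "D (0, h) = D (0, 1) * h"
      using linear_scale[OF lin, of h "(0, 1)"] by simp
  qed
  ultimately have "((\<lambda>\<tau>. v x \<tau>) has_real_derivative D (0, 1)) (at t)"
    by (simp only: has_field_derivative_def)
  then have v_t: "deriv (\<lambda>\<tau>. v x \<tau>) t = D (0, 1)"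
    by (rule DERIV_imp_deriv)
  define \<alpha> where "\<alpha> = iota l p"
  \<comment> \<open>Constant extension to times before \<open>t\<close>, because the comparison is
    needed on both sides of \<open>t\<close>.\<close>
  define u where "u s = ctrl p (max t s)" for s
  define z where "z = x + displacement p"
  \<comment> \<open>Written backwards from the final point \<open>z\<close>, the curve is also
    defined for \<open>\<tau> < t\<close>, and each of its tails ends at \<open>z\<close>, which
    keeps the argument of \<open>g\<close> fixed.\<close>
  define y where "y \<tau> = z - integral {\<tau>..T} u" for \<tau>
  have u_eq: "u s = ctrl p s" if "s \<in> {t..T}" for s using that by (simp add: u_def max_def)
  have cont_u: "continuous_on {0..T} u"
    unfolding u_def using t
    by (intro continuous_on_compose2[OF continuous_ctrl] continuous_on_max continuous_on_const continuous_on_id) auto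
  have u_t: "u t = \<alpha>" using diagonal[of t] t by (simp add: u_def ctrl_def \<alpha>_def)
  have int_u: "integral {t..T} u = displacement p"
    unfolding displacement_def using u_eq by (intro integral_cong) auto
  have y_t: "y t = x" by (simp add: y_def z_def int_u)
  have y': "(y has_vector_derivative \<alpha>) (at t)"
  proof -
    have "(y has_vector_derivative 0 - - u t) (at t within {0..T})"
      unfolding y_def using cont_u t
      by (intro has_vector_derivative_diff has_vector_derivative_const integral_has_vector_derivative') auto
    then show ?thesis using at_within_Icc_at[OF t] u_t by simp
  qed
  define H where "H \<tau> = integral {\<tau>..T} (\<lambda>s. d \<tau> s * l (u s))" for \<tau>
  define I where "I = (LINT s:{t..T}|lebesgue. d_dt d t s * l (u s))"
  have cont_lu: "continuous_on {0..T} (\<lambda>s. l (u s))"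
    by (rule continuous_on_compose2[OF continuous cont_u]) auto
  have H': "(H has_real_derivative I - l \<alpha>) (at t)"
    unfolding H_def I_def using DERIV_running_cost[OF cont_lu t] by (simp add: u_t)
  have upper: "v (y \<tau>) \<tau> \<le> H \<tau> + d \<tau> T * g z" if "\<tau> \<in> {0<..<T}" for \<tau>
  proof -
    interpret at_\<tau>: discounted_problem l g d a \<tau> T L
      by (rule problem_at) (use that in simp)
    have "continuous_on {\<tau>..T} u" using cont_u that by (auto intro: continuous_on_subset)
    from at_\<tau>.value_le[OF this, of "y \<tau>"] show ?thesis
      by (simp add: v_def at_\<tau>.running_def H_def y_def)
  qed
  have equality: "v (y t) t = H t + d t T * g z"
  proof -
    have "running (ctrl p) = H t"
      unfolding running_def H_def using u_eq by (intro integral_cong) auto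
    then show ?thesis using p by (simp add: y_t v_def extremal_cost_def z_def)
  qed
  define F where "F \<tau> = v (y \<tau>) \<tau> - (H \<tau> + d \<tau> T * g z)" for \<tau>
  have "((\<lambda>\<tau>. v (y \<tau>) \<tau>) has_real_derivative D (\<alpha>, 1)) (at t)"
  proof -
    have "((\<lambda>\<tau>. (y \<tau>, \<tau>)) has_derivative (\<lambda>h. (h *\<^sub>R \<alpha>, h))) (at t)"
      using y' unfolding has_vector_derivative_def by (intro has_derivative_Pair has_derivative_ident)
    then have "((\<lambda>\<tau>. v (y \<tau>) \<tau>) has_derivative (\<lambda>h. D (h *\<^sub>R \<alpha>, h))) (at t)"
      using has_derivative_compose[of "\<lambda>\<tau>. (y \<tau>, \<tau>)" "\<lambda>h. (h *\<^sub>R \<alpha>, h)" t UNIV "\<lambda>(z, \<tau>). v z \<tau>" D] D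
      by (simp add: y_t)
    moreover have "(\<lambda>h. D (h *\<^sub>R \<alpha>, h)) = (*) (D (\<alpha>, 1))"
    proof
      fix h
      show "D (h *\<^sub>R \<alpha>, h) = D (\<alpha>, 1) * h"
        using linear_scale[OF lin, of h "(\<alpha>, 1)"] by simp
    qed
    ultimately show ?thesis by (simp only: has_field_derivative_def)
  qed
  then have "(F has_real_derivative D (\<alpha>, 1) - ((I - l \<alpha>) + d_dt d t T * g z)) (at t)"
    unfolding F_def using DERIV_d[of t T] t
    by (intro DERIV_diff DERIV_add H' DERIV_cmult_right) auto
  moreover have "0 < min t (T - t)" using t by simp
  moreover have "\<forall>\<tau>. \<bar>t - \<tau>\<bar> < min t (T - t) \<longrightarrow> F \<tau> \<le> F t"
  proof (intro allI impI)
    fix \<tau> assume "\<bar>t - \<tau>\<bar> < min t (T - t)"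
    then have "\<tau> \<in> {0<..<T}" by auto
    from upper[OF this] equality show "F \<tau> \<le> F t" by (simp add: F_def)
  qed
  ultimately have "D (\<alpha>, 1) - ((I - l \<alpha>) + d_dt d t T * g z) = 0"
    by (rule DERIV_local_max)
  moreover have "D (\<alpha>, 1) = - (\<alpha> \<bullet> p) + D (0, 1)"
    using linear_add[OF lin, of "(\<alpha>, 0)" "(0, 1)"] Dx[of \<alpha>] by simp
  moreover have "w T l g d x t \<alpha> = I + d_dt d t T * g z"
  proof -
    have U_eq: "U l d t \<alpha> s = ctrl p s" for s by (simp add: U_def \<alpha>_def ctrl_def)
    have "(LINT s:{t..T}|lebesgue. U l d t \<alpha> s) = displacement p"
    proof -
      have int: "integrable (lebesgue_on {t..T}) (ctrl p)"
        by (rule continuous_imp_integrable_real[OF continuous_ctrl])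
      have "(LINT s:{t..T}|lebesgue. U l d t \<alpha> s) = integral\<^sup>L (lebesgue_on {t..T}) (ctrl p)"
        by (simp add: U_eq integral_restrict_space set_lebesgue_integral_def)
      also have "\<dots> = displacement p"
        unfolding displacement_def by (rule lebesgue_integral_eq_integral[OF int]) simp
      finally show ?thesis .
    qed
    then have "Y l d t x \<alpha> T = z" by (simp add: Y_def z_def)
    moreover have "(LINT s:{t..T}|lebesgue. d_dt d t s * l (U l d t \<alpha> s)) = I"
      unfolding I_def by (rule set_lebesgue_integral_cong) (auto simp: U_eq u_eq)
    ultimately show ?thesis by (simp add: w_def)
  qed
  ultimately show ?thesis
    by (simp add: v_t v_x conjugate_eq \<alpha>_def[symmetric] inner_commute)
qed

end

theorem theorem4p2:
  fixes T a :: real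
    and \<l> g :: "real^'n \<Rightarrow> real"
    and d :: "real \<Rightarrow> real \<Rightarrow> real"
  assumes "T > 0"
    and "C2 \<l>"
    and "strictly_convex \<l>"
    and "filterlim (\<lambda>u. \<l> u / norm u) at_top at_infinity"
    and "\<And>u. positive_definite (hessian \<l> u)"
    and "\<exists>L. L-lipschitz_on UNIV g"
    and "\<And>z. g differentiable (at z)"
    and "a > 0"
    and "\<And>t s. t \<in> {0..T} \<Longrightarrow> s \<in> {0..T} \<Longrightarrow> d t s \<in> {a<..1}"
    and "\<exists>L. L-lipschitz_on ({0..T} \<times> {0..T}) (\<lambda>(t, s). d t s)"
    and "\<And>t. t \<in> {0..T} \<Longrightarrow> d t t = 1"
    and "\<And>t s. 0 \<le> t \<Longrightarrow> t \<le> s \<Longrightarrow> s \<le> T \<Longrightarrow> (\<lambda>\<tau>. d \<tau> s) differentiable (at t within {0..s})"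
    and "\<And>s. s \<in> {0..T} \<Longrightarrow> continuous_on {0..s} (\<lambda>t. d t s)"
    and "\<And>s. s \<in> {0..T} \<Longrightarrow> continuous_on {0..s} (\<lambda>t. d_dt d t s)"
    and "\<And>t. t \<in> {0..T} \<Longrightarrow> set_integrable lebesgue {t..T} (\<lambda>s. d t s)"
    and "\<And>t. t \<in> {0..T} \<Longrightarrow> set_integrable lebesgue {t..T} (\<lambda>s. d_dt d t s)"
  shows "\<forall>x. \<forall>t\<in>{0<..<T}.
    (\<lambda>(z, \<tau>). value_function T \<l> g d z \<tau>) differentiable (at (x, t)) \<longrightarrow>
    (let v = value_function T \<l> g d;
         v_x = gradient (\<lambda>z. v z t) x;
         v_t = deriv (\<lambda>\<tau>. v x \<tau>) t
     in - v_t + conjugate \<l> (- v_x) + w T \<l> g d x t (iota \<l> (- v_x)) = 0)"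
proof -
  obtain L where L: "L-lipschitz_on UNIV g" using assms(6) by blast
  obtain K where K: "K-lipschitz_on ({0..T} \<times> {0..T}) (\<lambda>(t, s). d t s)" using assms(10) by blast
  interpret time_dependent_discount \<l> g d a T L K
  proof
    show "\<l> differentiable (at u)" for u using assms(2) by (simp add: C2_def)
    show "continuous_on UNIV (gradient \<l>)"
      using assms(2) by (intro differentiable_imp_continuous_on) (simp add: C2_def differentiable_on_def)
  qed (fact assms L K)+
  show ?thesis
    unfolding Let_def using Hamilton_Jacobi by simp
qed

end
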